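(* Let $\mathbb K$ be a commutative unital ring, $(U,V)$ a linear set, $N=\{a_1<\dots<a_n\}\subset\mathbb N$, $\alpha=\{\alpha_1<\dots<\alpha_k\}\subset N$ a vertex and $(\beta,\alpha)$ an edge, $\beta=\alpha\setminus\{\alpha_i\}$ for some $i\in\{1,\dots,k\}$. The target edge projections $\pi^{\beta,\alpha;N}_U:\mathsf G^{\alpha;N}U\to\mathsf G^{\beta;N}U$ of the $n$-fold groupoid $\mathsf G^NU$ are polynomial and can be computed inductively as follows. For $n=1$, $\pi^{\emptyset,\{a_1\};\{a_1\}}_U(v_0,v_1,t_1)=(v_0+t_1v_1,t_1)$. For $n>1$, with $N'=N\setminus\{a_n\}$: (1) (old edge) if $\alpha_i\le\alpha_k<a_n$, then $\pi^{\beta,\alpha;N}_U=\pi^{\beta,\alpha;N'}_U\times\mathrm{id}_{\mathbb K}$; (2) (copy of old edge) if $\alpha_i<\alpha_k=a_n$, then $\pi^{\beta,\alpha;N}_U=\bigl(\pi^{\beta',\alpha';N'}_U\bigr)^{\{a_n\}}$, where $\alpha'=\alpha\setminus\{a_n\}$, $\beta'=\beta\setminus\{a_n\}$; (3) (new edge) if $\alpha_i=\alpha_k=a_n$, then, with $\alpha'=\alpha\setminus\{a_n\}=\beta$, $\pi^{\beta,\alpha;N}_U$ is the target projection $\pi^{\emptyset,\{a_n\};\{a_n\}}_{X}$ of the groupoid $\mathsf G^{\{a_n\}}X$ for $X=\mathsf G^{\alpha';N'}U$, i.e. $(x,v,t)\mapsto(x+tv,t)$.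
   Context: A linear set is a pair $(U,V)$, $V$ a $\mathbb K$-module, $U\subset V$. A polynomial law $P:V\to W$ is a family $P_A:V\otimes A\to W\otimes A$ natural in commutative $\mathbb K$-algebras $A$; $P^{[1]}$ is the polynomial law with $P_{A[T]}(x+Tv)=P_A(x)+TF$, $F\in W\otimes A[T]$, $P^{[1]}_A(x,v,t)=F|_{T=t}$, and $P^{\{k\}}(x,v,t)=(P(x),P^{[1]}(x,v,t),t)$. "Polynomial" means: given by restriction of a polynomial law between the ambient modules. For a subset $X$ of a module $E$ and a label $k$, $\mathsf G^{\{k\}}X$ is the groupoid with object set $X\times\mathbb K$, morphism set $X^{\{k\}}=\{(x,v,t)\in E^2\times\mathbb K:x\in X,\ x+tv\in X\}$, source $(x,t)$, target $(x+tv,t)$, unit $(x,0,t)$, product $(x',v',t)*(x,v,t)=(x,v+v',t)$. An $n$-fold groupoid indexed by $N$ is a family of sets $(C_\alpha)_{\alpha\subset N}$ with, for each edge $(\beta,\alpha)$ ($\alpha=\beta\cup\{i\}$, $i\notin\beta$), a groupoid with morphisms $C_\alpha$, objects $C_\beta$, such that every face yields a double groupoid. The $n$-fold groupoid $\mathsf G^NU=(\mathsf G^{\{a_n\}}\circ\dots\circ\mathsf G^{\{a_1\}})U$, with vertex sets $\mathsf G^{\alpha;N}U$, is obtained from the $(n-1)$-fold groupoid $\mathsf G^{N'}U$ by applying $\mathsf G^{\{a_n\}}$ to all its vertex sets and structure maps: each vertex set $X$ at $\alpha\subset N'$ yields $X\times\mathbb K$ at $\alpha$ and $X^{\{a_n\}}$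 at $\alpha\cup\{a_n\}$, with the groupoid $\mathsf G^{\{a_n\}}X$ as the edge groupoid of $(\alpha,\alpha\cup\{a_n\})$; each structure map $f$ of an edge of $\mathsf G^{N'}U$ yields the pair of maps $\mathsf G^{\{a_n\}}f=(f\times\mathrm{id}_{\mathbb K},f^{\{a_n\}})$ on the old edge and on its copy (both endpoints enlarged by $a_n$). *)

theory Defs
  imports "HOL-Algebra.Free_Abelian_Groups" "HOL-Algebra.Module" "HOL-Algebra.UnivPoly"
begin

section \<open>Tensor products\<close>

text \<open>
  The abelian group \<open>M \<otimes> A\<close> over \<open>K\<close>: the free abelian group on \<open>M \<times> A\<close> modulo the subgroup
  generated by the bilinearity relations.  Only the additive part of the \<open>ring\<close> record is used;
  the scalar action of a \<open>K\<close>-algebra \<open>A\<close> is \<open>tensor_scale\<close> below.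
\<close>

type_synonym ('m, 'a) tensor = "(('m \<times> 'a) \<Rightarrow>\<^sub>0 int) set"

definition tensor_relators ::
  "'k ring \<Rightarrow> ('k, 'm) module \<Rightarrow> ('k, 'a) module \<Rightarrow> (('m \<times> 'a) \<Rightarrow>\<^sub>0 int) set" where
  "tensor_relators K M A =
     {frag_of (x \<oplus>\<^bsub>M\<^esub> y, a) - frag_of (x, a) - frag_of (y, a) | x y a.
        x \<in> carrier M \<and> y \<in> carrier M \<and> a \<in> carrier A}
   \<union> {frag_of (x, a \<oplus>\<^bsub>A\<^esub> b) - frag_of (x, a) - frag_of (x, b) | x a b.
        x \<in> carrier M \<and> a \<in> carrier A \<and> b \<in> carrier A}
   \<union> {frag_of (k \<odot>\<^bsub>M\<^esub> x, a) - frag_of (x, k \<odot>\<^bsub>A\<^esub> a) | k x a.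
        k \<in> carrier K \<and> x \<in> carrier M \<and> a \<in> carrier A}"

definition tensor_null ::
  "'k ring \<Rightarrow> ('k, 'm) module \<Rightarrow> ('k, 'a) module \<Rightarrow> (('m \<times> 'a) \<Rightarrow>\<^sub>0 int) set" where
  "tensor_null K M A =
     generate (free_Abelian_group (carrier M \<times> carrier A)) (tensor_relators K M A)"

definition tensor_product ::
  "'k ring \<Rightarrow> ('k, 'm) module \<Rightarrow> ('k, 'a) module \<Rightarrow> ('m, 'a) tensor ring" where
  "tensor_product K M A =
     (let Q = free_Abelian_group (carrier M \<times> carrier A) Mod tensor_null K M A
      in \<lparr>carrier = carrier Q, mult = undefined, one = undefined,
          zero = \<one>\<^bsub>Q\<^esub>, add = (\<otimes>\<^bsub>Q\<^esub>)\<rparr>)"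

definition pure_tensor ::
  "'k ring \<Rightarrow> ('k, 'm) module \<Rightarrow> ('k, 'a) module \<Rightarrow> 'm \<Rightarrow> 'a \<Rightarrow> ('m, 'a) tensor" where
  "pure_tensor K M A x a =
     tensor_null K M A #>\<^bsub>free_Abelian_group (carrier M \<times> carrier A)\<^esub> frag_of (x, a)"

text \<open>
  The additive map \<open>M \<otimes> A \<rightarrow> G\<close> induced by a balanced biadditive map \<open>\<phi>\<close>; meaningful only for
  such \<open>\<phi>\<close>, for which the image of the coset \<open>C\<close> below is a singleton.
\<close>

definition tensor_lift ::
  "('g, 'r) ring_scheme \<Rightarrow> ('m \<Rightarrow> 'a \<Rightarrow> 'g) \<Rightarrow> ('m, 'a) tensor \<Rightarrow> 'g" where
  "tensor_lift G \<phi> C =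
     the_elem ((\<lambda>c. \<Oplus>\<^bsub>G\<^esub>p \<in> Poly_Mapping.keys c.
                   [Poly_Mapping.lookup c p] \<cdot>\<^bsub>G\<^esub> \<phi> (fst p) (snd p)) ` C)"

text \<open>\<open>f \<otimes> g : M \<otimes> A \<rightarrow> N \<otimes> B\<close>, for \<open>K\<close>-linear \<open>f\<close> and \<open>g\<close>.\<close>

definition tensor_map ::
  "'k ring \<Rightarrow> ('k, 'n) module \<Rightarrow> ('k, 'b) module \<Rightarrow> ('m \<Rightarrow> 'n) \<Rightarrow> ('a \<Rightarrow> 'b)
   \<Rightarrow> ('m, 'a) tensor \<Rightarrow> ('n, 'b) tensor" where
  "tensor_map K N B f g =
     tensor_lift (tensor_product K N B) (\<lambda>x a. pure_tensor K N B (f x) (g a))"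

definition tensor_scale ::
  "'k ring \<Rightarrow> ('k, 'm) module \<Rightarrow> ('k, 'a) module \<Rightarrow> 'a \<Rightarrow> ('m, 'a) tensor \<Rightarrow> ('m, 'a) tensor" where
  "tensor_scale K M A a = tensor_map K M A id (\<lambda>b. a \<otimes>\<^bsub>A\<^esub> b)"


section \<open>Test algebras\<close>

text \<open>
  HOL cannot quantify over all types inside a formula, so the algebras \<open>A\<close> over which a polynomial
  law is evaluated have their carriers in one type.  It contains a copy of \<open>K\<close> (\<open>Const\<close>), is closed
  under \<open>A \<mapsto> A[T]\<close> (\<open>Seq\<close>, coefficient sequences), and contains a copy of every \<open>K\<close>-algebra with
  carrier in \<open>'x\<close> (\<open>Ext\<close>), where \<open>'x\<close> is an arbitrary type; every type is thus covered by
  instantiating \<open>'x\<close>.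
\<close>

datatype ('k, 'x) test = Const (const_val: 'k) | Ext 'x | Seq (coeffs: "nat \<Rightarrow> ('k, 'x) test")

type_synonym ('k, 'x) test_algebra = "('k, ('k, 'x) test) module"

definition base_algebra :: "'k ring \<Rightarrow> ('k, 'x) test_algebra" where
  "base_algebra K =
     \<lparr>carrier = Const ` carrier K,
      mult = (\<lambda>a b. Const (const_val a \<otimes>\<^bsub>K\<^esub> const_val b)), one = Const \<one>\<^bsub>K\<^esub>,
      zero = Const \<zero>\<^bsub>K\<^esub>, add = (\<lambda>a b. Const (const_val a \<oplus>\<^bsub>K\<^esub> const_val b)),
      smult = (\<lambda>k a. Const (k \<otimes>\<^bsub>K\<^esub> const_val a))\<rparr>"

text \<open>\<open>A[T]\<close> as a \<open>K\<close>-algebra: the library's polynomial ring \<open>UP A\<close>, transported along \<open>Seq\<close>.\<close>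

definition poly_algebra :: "('k, 'x) test_algebra \<Rightarrow> ('k, 'x) test_algebra" where
  "poly_algebra A =
     \<lparr>carrier = Seq ` carrier (UP A),
      mult = (\<lambda>p q. Seq (coeffs p \<otimes>\<^bsub>UP A\<^esub> coeffs q)), one = Seq \<one>\<^bsub>UP A\<^esub>,
      zero = Seq \<zero>\<^bsub>UP A\<^esub>, add = (\<lambda>p q. Seq (coeffs p \<oplus>\<^bsub>UP A\<^esub> coeffs q)),
      smult = (\<lambda>k p. Seq (\<lambda>i. k \<odot>\<^bsub>A\<^esub> coeffs p i))\<rparr>"

definition poly_const :: "('k, 'x) test_algebra \<Rightarrow> ('k, 'x) test \<Rightarrow> ('k, 'x) test" where
  "poly_const A a = Seq (up_ring.monom (UP A) a 0)"

definition poly_var :: "('k, 'x) test_algebra \<Rightarrow> ('k, 'x) test" where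
  "poly_var A = Seq (up_ring.monom (UP A) \<one>\<^bsub>A\<^esub> 1)"

definition poly_eval ::
  "('k, 'x) test_algebra \<Rightarrow> ('k, 'x) test \<Rightarrow> ('k, 'x) test \<Rightarrow> ('k, 'x) test" where
  "poly_eval A t p = UnivPoly.eval A A id t (coeffs p)"

definition algebra_hom ::
  "'k ring \<Rightarrow> ('k, 'a) module \<Rightarrow> ('k, 'b) module \<Rightarrow> ('a \<Rightarrow> 'b) set" where
  "algebra_hom K A B =
     {\<phi> \<in> ring_hom A B. \<forall>k \<in> carrier K. \<forall>a \<in> carrier A. \<phi> (k \<odot>\<^bsub>A\<^esub> a) = k \<odot>\<^bsub>B\<^esub> \<phi> a}"


section \<open>Polynomial laws\<close>

type_synonym ('k, 'x, 'm, 'n) law =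
  "('k, 'x) test_algebra \<Rightarrow> ('m, ('k, 'x) test) tensor \<Rightarrow> ('n, ('k, 'x) test) tensor"

definition polynomial_law ::
  "'k ring \<Rightarrow> ('k, 'm) module \<Rightarrow> ('k, 'n) module \<Rightarrow> ('k, 'x, 'm, 'n) law \<Rightarrow> bool" where
  "polynomial_law K M N P \<longleftrightarrow>
     (\<forall>A. algebra K A \<longrightarrow>
        P A \<in> carrier (tensor_product K M A) \<rightarrow> carrier (tensor_product K N A)) \<and>
     (\<forall>A B \<phi>. algebra K A \<and> algebra K B \<and> \<phi> \<in> algebra_hom K A B \<longrightarrow>
        (\<forall>z \<in> carrier (tensor_product K M A).
           P B (tensor_map K M B id \<phi> z) = tensor_map K N B id \<phi> (P A z)))"

text \<open>The underlying map \<open>P\<^sub>K : M \<rightarrow> N\<close>, under \<open>M \<cong> M \<otimes> K\<close> and \<open>N \<otimes> K \<cong> N\<close>.\<close>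

definition law_map ::
  "'k ring \<Rightarrow> ('k, 'm) module \<Rightarrow> ('k, 'n) module \<Rightarrow> ('k, 'x, 'm, 'n) law \<Rightarrow> 'm \<Rightarrow> 'n" where
  "law_map K M N P x =
     tensor_lift N (\<lambda>y c. const_val c \<odot>\<^bsub>N\<^esub> y)
       (P (base_algebra K) (pure_tensor K M (base_algebra K) x (Const \<one>\<^bsub>K\<^esub>)))"

text \<open>\<open>f : X \<rightarrow> Y\<close> is polynomial, being the restriction to \<open>X \<subseteq> M\<close> of the polynomial law \<open>P\<close> from \<open>M\<close>
  to \<open>N \<supseteq> Y\<close>.\<close>

definition polynomial_via ::
  "'k ring \<Rightarrow> ('k, 'm) module \<Rightarrow> ('k, 'n) module \<Rightarrow> 'm set \<Rightarrow> 'n set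
   \<Rightarrow> ('k, 'x, 'm, 'n) law \<Rightarrow> ('m \<Rightarrow> 'n) \<Rightarrow> bool" where
  "polynomial_via K M N X Y P f \<longleftrightarrow>
     polynomial_law K M N P \<and> f \<in> X \<rightarrow>\<^sub>E Y \<and> (\<forall>x \<in> X. f x = law_map K M N P x)"

definition linear_law :: "'k ring \<Rightarrow> ('k, 'n) module \<Rightarrow> ('m \<Rightarrow> 'n) \<Rightarrow> ('k, 'x, 'm, 'n) law" where
  "linear_law K N f = (\<lambda>A. tensor_map K N A f id)"

definition law_comp :: "('k, 'x, 'n, 'p) law \<Rightarrow> ('k, 'x, 'm, 'n) law \<Rightarrow> ('k, 'x, 'm, 'p) law" where
  "law_comp Q P = (\<lambda>A z. Q A (P A z))"


section \<open>Points and their modules\<close>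

text \<open>
  The ambient modules of the vertex sets are iterated products of \<open>V\<close> and \<open>K\<close> whose shape depends on
  the vertex.  They are all realised on one type of points, the free one over \<open>V\<close> and \<open>K\<close>; a triple
  \<open>(x, v, t)\<close> is \<open>\<langle>x, \<langle>v, Scal t\<rangle>\<rangle>\<close> and a pair \<open>(x, t)\<close> is \<open>\<langle>x, Scal t\<rangle>\<close>.
\<close>

datatype ('k, 'v) point =
    Vec (vec: 'v)
  | Scal (scal: 'k)
  | Pair (pfst: "('k, 'v) point") (psnd: "('k, 'v) point")  (\<open>\<langle>_,/ _\<rangle>\<close>)

type_synonym ('k, 'v) pmodule = "('k, ('k, 'v) point) module"
type_synonym ('k, 'v, 'x) plaw = "('k, 'x, ('k, 'v) point, ('k, 'v) point) law"
type_synonym ('k, 'v) linear_set = "('k, 'v) point set \<times> ('k, 'v) pmodule"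

definition vec_module :: "('k, 'v) module \<Rightarrow> ('k, 'v) pmodule" where
  "vec_module V =
     \<lparr>carrier = Vec ` carrier V, mult = undefined, one = undefined,
      zero = Vec \<zero>\<^bsub>V\<^esub>, add = (\<lambda>x y. Vec (vec x \<oplus>\<^bsub>V\<^esub> vec y)),
      smult = (\<lambda>k x. Vec (k \<odot>\<^bsub>V\<^esub> vec x))\<rparr>"

definition scal_module :: "'k ring \<Rightarrow> ('k, 'v) pmodule" where
  "scal_module K =
     \<lparr>carrier = Scal ` carrier K, mult = undefined, one = undefined,
      zero = Scal \<zero>\<^bsub>K\<^esub>, add = (\<lambda>x y. Scal (scal x \<oplus>\<^bsub>K\<^esub> scal y)),
      smult = (\<lambda>k x. Scal (k \<otimes>\<^bsub>K\<^esub> scal x))\<rparr>"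

definition prod_module :: "('k, 'v) pmodule \<Rightarrow> ('k, 'v) pmodule \<Rightarrow> ('k, 'v) pmodule" where
  "prod_module E F =
     \<lparr>carrier = {\<langle>x, y\<rangle> | x y. x \<in> carrier E \<and> y \<in> carrier F}, mult = undefined, one = undefined,
      zero = \<langle>\<zero>\<^bsub>E\<^esub>, \<zero>\<^bsub>F\<^esub>\<rangle>,
      add = (\<lambda>p q. \<langle>pfst p \<oplus>\<^bsub>E\<^esub> pfst q, psnd p \<oplus>\<^bsub>F\<^esub> psnd q\<rangle>),
      smult = (\<lambda>k p. \<langle>k \<odot>\<^bsub>E\<^esub> pfst p, k \<odot>\<^bsub>F\<^esub> psnd p\<rangle>)\<rparr>"

text \<open>\<open>E \<times> K\<close> and \<open>E\<^sup>2 \<times> K\<close>, and in them the objects \<open>X \<times> K\<close> and the morphisms \<open>X^{a}\<close> of the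
  groupoid attached to \<open>X \<subseteq> E\<close>.  The label \<open>a\<close> plays no role in the sets.\<close>

definition obj_module :: "'k ring \<Rightarrow> ('k, 'v) pmodule \<Rightarrow> ('k, 'v) pmodule" where
  "obj_module K E = prod_module E (scal_module K)"

definition mor_module :: "'k ring \<Rightarrow> ('k, 'v) pmodule \<Rightarrow> ('k, 'v) pmodule" where
  "mor_module K E = prod_module E (prod_module E (scal_module K))"

definition obj_set :: "'k ring \<Rightarrow> ('k, 'v) point set \<Rightarrow> ('k, 'v) point set" where
  "obj_set K X = {\<langle>x, Scal t\<rangle> | x t. x \<in> X \<and> t \<in> carrier K}"

definition mor_set ::
  "'k ring \<Rightarrow> ('k, 'v) pmodule \<Rightarrow> ('k, 'v) point set \<Rightarrow> ('k, 'v) point set" where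
  "mor_set K E X =
     {\<langle>x, \<langle>v, Scal t\<rangle>\<rangle> | x v t.
        x \<in> X \<and> v \<in> carrier E \<and> t \<in> carrier K \<and> x \<oplus>\<^bsub>E\<^esub> t \<odot>\<^bsub>E\<^esub> v \<in> X}"


section \<open>The functor on polynomial laws\<close>

definition law_pair ::
  "'k ring \<Rightarrow> ('k, 'v) pmodule \<Rightarrow> ('k, 'v) pmodule
   \<Rightarrow> ('k, 'v, 'x) plaw \<Rightarrow> ('k, 'v, 'x) plaw \<Rightarrow> ('k, 'v, 'x) plaw" where
  "law_pair K E F P Q =
     (\<lambda>A z. linear_law K (prod_module E F) (\<lambda>x. \<langle>x, \<zero>\<^bsub>F\<^esub>\<rangle>) A (P A z)
              \<oplus>\<^bsub>tensor_product K (prod_module E F) A\<^esub>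
            linear_law K (prod_module E F) (\<lambda>y. \<langle>\<zero>\<^bsub>E\<^esub>, y\<rangle>) A (Q A z))"

text \<open>The components of \<open>z \<in> (E\<^sup>2 \<times> K) \<otimes> A \<cong> (E \<otimes> A)\<^sup>2 \<times> A\<close>.\<close>

definition mor_x :: "'k ring \<Rightarrow> ('k, 'v) pmodule \<Rightarrow> ('k, 'v, 'x) plaw" where
  "mor_x K E = linear_law K E pfst"

definition mor_v :: "'k ring \<Rightarrow> ('k, 'v) pmodule \<Rightarrow> ('k, 'v, 'x) plaw" where
  "mor_v K E = linear_law K E (\<lambda>p. pfst (psnd p))"

definition mor_k :: "'k ring \<Rightarrow> ('k, 'v, 'x) plaw" where
  "mor_k K = linear_law K (scal_module K) (\<lambda>p. psnd (psnd p))"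

definition mor_t ::
  "('k, 'x) test_algebra \<Rightarrow> (('k, 'v) point, ('k, 'x) test) tensor \<Rightarrow> ('k, 'x) test" where
  "mor_t A = tensor_lift A (\<lambda>p a. scal (psnd (psnd p)) \<odot>\<^bsub>A\<^esub> a)"

text \<open>
  \<open>P\<^sup>[\<^sup>1\<^sup>]\<close>: over \<open>A\<close>, the value at \<open>(x, v, t)\<close> is \<open>F|\<^sub>T\<^sub>=\<^sub>t\<close> for the unique
  \<open>F \<in> N \<otimes> A[T]\<close> with \<open>P (x + Tv) = P x + TF\<close> over \<open>A[T]\<close>.
\<close>

definition slope_law ::
  "'k ring \<Rightarrow> ('k, 'v) pmodule \<Rightarrow> ('k, 'v) pmodule
   \<Rightarrow> ('k, 'v, 'x) plaw \<Rightarrow> ('k, 'v, 'x) plaw" where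
  "slope_law K E F P =
     (\<lambda>A z.
        let B = poly_algebra A;
            x = mor_x K E A z; v = mor_v K E A z; t = mor_t A z;
            \<iota>\<^sub>E = tensor_map K E B id (poly_const A);
            \<iota>\<^sub>F = tensor_map K F B id (poly_const A);
            W = tensor_product K F B
        in tensor_map K F A id (poly_eval A t)
             (THE w. w \<in> carrier W \<and>
                P B (\<iota>\<^sub>E x \<oplus>\<^bsub>tensor_product K E B\<^esub> tensor_scale K E B (poly_var A) (\<iota>\<^sub>E v))
                  = \<iota>\<^sub>F (P A x) \<oplus>\<^bsub>W\<^esub> tensor_scale K F B (poly_var A) w))"

text \<open>\<open>P \<times> id\<close> and \<open>(x, v, t) \<mapsto> (P x, P\<^sup>[\<^sup>1\<^sup>] (x, v, t), t)\<close>, for \<open>P\<close> a law from \<open>E\<close> to \<open>F\<close>.\<close>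

definition obj_law ::
  "'k ring \<Rightarrow> ('k, 'v) pmodule \<Rightarrow> ('k, 'v) pmodule
   \<Rightarrow> ('k, 'v, 'x) plaw \<Rightarrow> ('k, 'v, 'x) plaw" where
  "obj_law K E F P =
     law_pair K F (scal_module K)
       (law_comp P (linear_law K E pfst)) (linear_law K (scal_module K) psnd)"

definition mor_law ::
  "'k ring \<Rightarrow> ('k, 'v) pmodule \<Rightarrow> ('k, 'v) pmodule
   \<Rightarrow> ('k, 'v, 'x) plaw \<Rightarrow> ('k, 'v, 'x) plaw" where
  "mor_law K E F P =
     law_pair K F (prod_module F (scal_module K))
       (law_comp P (mor_x K E))
       (law_pair K F (scal_module K) (slope_law K E F P) (mor_k K))"

text \<open>The same two constructions for maps: \<open>f \<times> id\<close> for \<open>f\<close> defined on \<open>X\<close>, and the extension to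
  the morphisms over \<open>X \<subseteq> E\<close> of the polynomial map that is given by the law \<open>P\<close>.\<close>

definition times_id ::
  "'k ring \<Rightarrow> ('k, 'v) point set \<Rightarrow> (('k, 'v) point \<Rightarrow> ('k, 'v) point)
   \<Rightarrow> ('k, 'v) point \<Rightarrow> ('k, 'v) point" where
  "times_id K X f = (\<lambda>p \<in> obj_set K X. \<langle>f (pfst p), psnd p\<rangle>)"

definition ext_map ::
  "'k ring \<Rightarrow> ('k, 'v) pmodule \<Rightarrow> ('k, 'v) pmodule \<Rightarrow> ('k, 'v) point set \<Rightarrow> ('k, 'v, 'x) plaw
   \<Rightarrow> ('k, 'v) point \<Rightarrow> ('k, 'v) point" where
  "ext_map K E F X P =
     (\<lambda>p \<in> mor_set K E X.
        \<langle>law_map K E F P (pfst p),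
         \<langle>law_map K (mor_module K E) F (slope_law K E F P) p, psnd (psnd p)\<rangle>\<rangle>)"


section \<open>The n-fold groupoid of a linear set\<close>

text \<open>
  A structure map of a groupoid of linear sets is stored as a polynomial law between the ambient
  modules, since the law is not determined by its restriction to the linear set and the functor needs
  it.  For morphism module \<open>M\<close> and object module \<open>O\<close>, source and target go from \<open>M\<close> to \<open>O\<close>, the unit
  from \<open>O\<close> to \<open>M\<close>, and the product from \<open>M \<times> M\<close> to \<open>M\<close>, to be restricted to composable pairs
  \<open>\<langle>g', g\<rangle>\<close>, where the source of \<open>g'\<close> is the target of \<open>g\<close>.
\<close>

record ('k, 'v, 'x) groupoid_laws =
  src :: "('k, 'v, 'x) plaw"
  tgt :: "('k, 'v, 'x) plaw"
  unit_law :: "('k, 'v, 'x) plaw"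
  prod_law :: "('k, 'v, 'x) plaw"

text \<open>The data of an n-fold groupoid of linear sets; the groupoid axioms are not part of the record.
  \<open>edge C \<beta> \<alpha>\<close> has morphisms \<open>vset C \<alpha>\<close> and objects \<open>vset C \<beta>\<close>.\<close>

record ('k, 'v, 'x) nfold_groupoid =
  vset :: "nat set \<Rightarrow> ('k, 'v) point set"
  amb :: "nat set \<Rightarrow> ('k, 'v) pmodule"
  edge :: "nat set \<Rightarrow> nat set \<Rightarrow> ('k, 'v, 'x) groupoid_laws"

text \<open>The laws depend on the ambient module \<open>E\<close> of \<open>X\<close> only.  The target is
  \<open>(x, v, t) \<mapsto> (x + tv, t)\<close> over every test algebra; the other structure maps are linear.\<close>

definition new_edge :: "'k ring \<Rightarrow> ('k, 'v) pmodule \<Rightarrow> ('k, 'v, 'x) groupoid_laws" where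
  "new_edge K E =
     \<lparr>src = linear_law K (obj_module K E) (\<lambda>p. \<langle>pfst p, psnd (psnd p)\<rangle>),
      tgt = law_pair K E (scal_module K)
              (\<lambda>A z. mor_x K E A z \<oplus>\<^bsub>tensor_product K E A\<^esub>
                     tensor_scale K E A (mor_t A z) (mor_v K E A z))
              (mor_k K),
      unit_law = linear_law K (mor_module K E) (\<lambda>p. \<langle>pfst p, \<langle>\<zero>\<^bsub>E\<^esub>, psnd p\<rangle>\<rangle>),
      prod_law = linear_law K (mor_module K E)
              (\<lambda>q. \<langle>pfst (psnd q),
                    \<langle>pfst (psnd (psnd q)) \<oplus>\<^bsub>E\<^esub> pfst (psnd (pfst q)), psnd (psnd (psnd q))\<rangle>\<rangle>)\<rparr>"

text \<open>
  An edge with morphism module \<open>M\<close> and object module \<open>O\<close>, multiplied by \<open>K\<close>, and its copy.  For the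
  product one first rearranges \<open>((x', t), (x, t))\<close> to \<open>((x', x), t)\<close> and \<open>((x', v', t), (x, v, t))\<close> to
  \<open>((x', x), (v', v), t)\<close>.
\<close>

definition old_edge ::
  "'k ring \<Rightarrow> ('k, 'v) pmodule \<Rightarrow> ('k, 'v) pmodule
   \<Rightarrow> ('k, 'v, 'x) groupoid_laws \<Rightarrow> ('k, 'v, 'x) groupoid_laws" where
  "old_edge K M O' g =
     \<lparr>src = obj_law K M O' (src g), tgt = obj_law K M O' (tgt g),
      unit_law = obj_law K O' M (unit_law g),
      prod_law = law_comp (obj_law K (prod_module M M) M (prod_law g))
        (linear_law K (obj_module K (prod_module M M))
          (\<lambda>q. \<langle>\<langle>pfst (pfst q), pfst (psnd q)\<rangle>, psnd (psnd q)\<rangle>))\<rparr>"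

definition copy_edge ::
  "'k ring \<Rightarrow> ('k, 'v) pmodule \<Rightarrow> ('k, 'v) pmodule
   \<Rightarrow> ('k, 'v, 'x) groupoid_laws \<Rightarrow> ('k, 'v, 'x) groupoid_laws" where
  "copy_edge K M O' g =
     \<lparr>src = mor_law K M O' (src g), tgt = mor_law K M O' (tgt g),
      unit_law = mor_law K O' M (unit_law g),
      prod_law = law_comp (mor_law K (prod_module M M) M (prod_law g))
        (linear_law K (mor_module K (prod_module M M))
          (\<lambda>q. \<langle>\<langle>pfst (pfst q), pfst (psnd q)\<rangle>,
                \<langle>\<langle>pfst (psnd (pfst q)), pfst (psnd (psnd q))\<rangle>, psnd (psnd (psnd q))\<rangle>\<rangle>))\<rparr>"

definition groupoid_step ::
  "'k ring \<Rightarrow> nat \<Rightarrow> ('k, 'v, 'x) nfold_groupoid \<Rightarrow> ('k, 'v, 'x) nfold_groupoid" where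
  "groupoid_step K a C =
     \<lparr>vset = (\<lambda>\<alpha>. if a \<in> \<alpha> then mor_set K (amb C (\<alpha> - {a})) (vset C (\<alpha> - {a}))
                  else obj_set K (vset C \<alpha>)),
      amb = (\<lambda>\<alpha>. if a \<in> \<alpha> then mor_module K (amb C (\<alpha> - {a})) else obj_module K (amb C \<alpha>)),
      edge = (\<lambda>\<beta> \<alpha>.
        if a \<in> \<beta> then copy_edge K (amb C (\<alpha> - {a})) (amb C (\<beta> - {a})) (edge C (\<beta> - {a}) (\<alpha> - {a}))
        else if a \<in> \<alpha> then new_edge K (amb C \<beta>)
        else old_edge K (amb C \<alpha>) (amb C \<beta>) (edge C \<beta> \<alpha>))\<rparr>"

text \<open>The 0-fold groupoid has the single vertex \<open>\<emptyset>\<close> and no edges.\<close>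

definition zerofold :: "('k, 'v) linear_set \<Rightarrow> ('k, 'v, 'x) nfold_groupoid" where
  "zerofold L = \<lparr>vset = (\<lambda>_. fst L), amb = (\<lambda>_. snd L), edge = undefined\<rparr>"

definition nfold_groupoid_of ::
  "'k ring \<Rightarrow> nat set \<Rightarrow> ('k, 'v) linear_set \<Rightarrow> ('k, 'v, 'x) nfold_groupoid" where
  "nfold_groupoid_of K N L = fold (groupoid_step K) (sorted_list_of_set N) (zerofold L)"

definition target_proj ::
  "'k ring \<Rightarrow> ('k, 'v, 'x) nfold_groupoid \<Rightarrow> nat set \<Rightarrow> nat set
   \<Rightarrow> ('k, 'v) point \<Rightarrow> ('k, 'v) point" where
  "target_proj K C \<beta> \<alpha> =
     (\<lambda>p \<in> vset C \<alpha>. law_map K (amb C \<alpha>) (amb C \<beta>) (tgt (edge C \<beta> \<alpha>)) p)"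

end

(*
  Write D : A[T] -> A[T] for the K-linear shift T^(n+1) |-> T^n, 1 |-> 0.  After tensoring with a module,
  D kills constants, is left inverse to multiplication by T, and every u equals u|_(T=0) + T * D u.  So the
  equation P(x + Tv) = P(x) + T F over A[T] has the unique solution F = D (P(x + Tv)), without any
  freeness argument; it is natural in A because D and the evaluation at t are, so P^[1] is again a
  polynomial law.  Evaluating at T = t gives P(x + tv) = P(x) + t P^[1](x,v,t), which says that the
  extension of a map from X to Y sends X^{a} to Y^{a}.  The theorem is then an induction over the
  largest label of N: an edge is the product with K of an old edge, the extension of an old edge, or a
  new edge.
*)

theory Submission
  imports Defs
begin

section \<open>Linear maps\<close>

text \<open>The obstacle is that \<open>P\<close> is not additive and commutes only with algebra
  homomorphisms. The shift D is merely K-linear, so it is never moved through \<open>P\<close>: it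
  acts on the value \<open>P (x + Tv)\<close> alone. The maps that are moved through
  \<open>P\<close> are the substitutions T = 0 and T = t and the coefficientwise extension of a
  homomorphism of algebras; T = 0 identifies the constant term of \<open>P (x + Tv)\<close>. Tensors
  are cosets in a free abelian group, and M \<otimes> A[T] is never identified with polynomials over
  M \<otimes> A. Instead, identities between K-linear maps are checked on the algebras and carried
  to tensors by functoriality, which rests on comparing additive maps on pure tensors. The
  difference quotient belongs to the law and not to the map on points. The induction therefore
  carries a statement about laws, for all edges of the smaller groupoid at once: each target law is
  polynomial and sends one vertex set into the other. Points enter over the base algebra, through x
  |-> x \<otimes> 1.\<close>

abbreviation add_hom ::
  "('a, 'r) ring_scheme \<Rightarrow> ('b, 's) ring_scheme \<Rightarrow> ('a \<Rightarrow> 'b) set" where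
  "add_hom G H \<equiv> hom (add_monoid G) (add_monoid H)"

lemma add_homI:
  assumes "\<And>x. x \<in> carrier G \<Longrightarrow> h x \<in> carrier H"
    and "\<And>x y. x \<in> carrier G \<Longrightarrow> y \<in> carrier G \<Longrightarrow> h (x \<oplus>\<^bsub>G\<^esub> y) = h x \<oplus>\<^bsub>H\<^esub> h y"
  shows "h \<in> add_hom G H"
  using assms by (auto simp: hom_def)

lemma add_hom_closed: "h \<in> add_hom G H \<Longrightarrow> x \<in> carrier G \<Longrightarrow> h x \<in> carrier H"
  by (auto simp: hom_def)

lemma add_hom_add:
  "h \<in> add_hom G H \<Longrightarrow> x \<in> carrier G \<Longrightarrow> y \<in> carrier G \<Longrightarrow> h (x \<oplus>\<^bsub>G\<^esub> y) = h x \<oplus>\<^bsub>H\<^esub> h y"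
  by (auto simp: hom_def)

definition module_hom :: "'k ring \<Rightarrow> ('k, 'm) module \<Rightarrow> ('k, 'n) module \<Rightarrow> ('m \<Rightarrow> 'n) set" where
  "module_hom K M N =
     {f \<in> add_hom M N. \<forall>k \<in> carrier K. \<forall>x \<in> carrier M. f (k \<odot>\<^bsub>M\<^esub> x) = k \<odot>\<^bsub>N\<^esub> f x}"

lemma module_homI:
  assumes "\<And>x. x \<in> carrier M \<Longrightarrow> f x \<in> carrier N"
    and "\<And>x y. x \<in> carrier M \<Longrightarrow> y \<in> carrier M \<Longrightarrow> f (x \<oplus>\<^bsub>M\<^esub> y) = f x \<oplus>\<^bsub>N\<^esub> f y"
    and "\<And>k x. k \<in> carrier K \<Longrightarrow> x \<in> carrier M \<Longrightarrow> f (k \<odot>\<^bsub>M\<^esub> x) = k \<odot>\<^bsub>N\<^esub> f x"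
  shows "f \<in> module_hom K M N"
  using assms by (auto simp: module_hom_def intro: add_homI)

lemma module_hom_add_hom: "f \<in> module_hom K M N \<Longrightarrow> f \<in> add_hom M N"
  by (simp add: module_hom_def)

lemma module_hom_closed: "f \<in> module_hom K M N \<Longrightarrow> x \<in> carrier M \<Longrightarrow> f x \<in> carrier N"
  by (auto simp: module_hom_def hom_def)

lemma module_hom_add:
  "f \<in> module_hom K M N \<Longrightarrow> x \<in> carrier M \<Longrightarrow> y \<in> carrier M \<Longrightarrow> f (x \<oplus>\<^bsub>M\<^esub> y) = f x \<oplus>\<^bsub>N\<^esub> f y"
  by (auto simp: module_hom_def hom_def)

lemma module_hom_smult:
  "f \<in> module_hom K M N \<Longrightarrow> k \<in> carrier K \<Longrightarrow> x \<in> carrier M \<Longrightarrow> f (k \<odot>\<^bsub>M\<^esub> x) = k \<odot>\<^bsub>N\<^esub> f x"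
  by (auto simp: module_hom_def)

lemma module_hom_id: "id \<in> module_hom K M M"
  by (auto intro: module_homI)

lemma module_hom_compose:
  "f \<in> module_hom K M N \<Longrightarrow> g \<in> module_hom K N P \<Longrightarrow> g \<circ> f \<in> module_hom K M P"
  by (rule module_homI) (auto simp: module_hom_closed module_hom_add module_hom_smult)

lemma module_abelian_group: "module K M \<Longrightarrow> abelian_group M"
  by (simp add: module_def)

section \<open>Tensor products\<close>

abbreviation tensor_free :: "('k, 'm) module \<Rightarrow> ('k, 'a) module \<Rightarrow> (('m \<times> 'a) \<Rightarrow>\<^sub>0 int) monoid" where
  "tensor_free M A \<equiv> free_Abelian_group (carrier M \<times> carrier A)"

lemma tensor_relators_subset:
  assumes M: "module K M" and A: "module K A"
  shows "tensor_relators K M A \<subseteq> carrier (tensor_free M A)"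
proof -
  interpret M: module K M by fact
  interpret A: module K A by fact
  show ?thesis
    unfolding tensor_relators_def
    by (auto dest!: subsetD[OF keys_diff] split: if_splits)
qed

lemma tensor_null_normal:
  assumes "module K M" "module K A"
  shows "tensor_null K M A \<lhd> tensor_free M A"
proof -
  interpret F: comm_group "tensor_free M A" by (rule abelian_free_Abelian_group)
  have "subgroup (tensor_null K M A) (tensor_free M A)"
    unfolding tensor_null_def by (rule F.generate_is_subgroup[OF tensor_relators_subset[OF assms]])
  then show ?thesis by (rule F.subgroup_imp_normal)
qed

lemma tensor_product_simps:
  "carrier (tensor_product K M A) = carrier (tensor_free M A Mod tensor_null K M A)"
  "zero (tensor_product K M A) = tensor_null K M A"
  "add (tensor_product K M A) = set_mult (tensor_free M A)"
  by (simp_all add: tensor_product_def Let_def)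

lemma tensor_abelian_group:
  assumes "module K M" "module K A"
  shows "abelian_group (tensor_product K M A)"
proof -
  interpret N: normal "tensor_null K M A" "tensor_free M A" by (rule tensor_null_normal[OF assms])
  interpret F: comm_group "tensor_free M A" by (rule abelian_free_Abelian_group)
  have Q: "comm_group (tensor_free M A Mod tensor_null K M A)"
    using F.abelian_FactGroup N.subgroup_axioms by blast
  \<comment> \<open>The record is built so that its additive part is literally the factor group,
    which is how the library's group theory becomes available.\<close>
  have "add_monoid (tensor_product K M A) = tensor_free M A Mod tensor_null K M A"
    by (simp add: tensor_product_def Let_def FactGroup_def)
  with Q show ?thesis
    by (simp add: abelian_group_def abelian_group_axioms_def abelian_monoid_def comm_group_def)
qed

lemma tensor_coset_hom:
  assumes "module K M" "module K A"
  shows "(\<lambda>c. tensor_null K M A #>\<^bsub>tensor_free M A\<^esub> c)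
    \<in> hom (tensor_free M A) (add_monoid (tensor_product K M A))"
proof -
  interpret N: normal "tensor_null K M A" "tensor_free M A" by (rule tensor_null_normal[OF assms])
  have "add_monoid (tensor_product K M A) = tensor_free M A Mod tensor_null K M A"
    by (simp add: tensor_product_def Let_def FactGroup_def)
  then show ?thesis using N.r_coset_hom_Mod by simp
qed

lemma pure_tensor_closed:
  assumes "module K M" "module K A" "x \<in> carrier M" "a \<in> carrier A"
  shows "pure_tensor K M A x a \<in> carrier (tensor_product K M A)"
proof -
  have "frag_of (x, a) \<in> carrier (tensor_free M A)"
    using assms by simp
  from hom_carrier[OF tensor_coset_hom[OF assms(1,2)]] this show ?thesis
    by (auto simp: pure_tensor_def)
qed

lemma tensor_coset_eq:
  assumes "module K M" "module K A"
    and "c \<in> carrier (tensor_free M A)" "d \<in> carrier (tensor_free M A)" "c - d \<in> tensor_null K M A"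
  shows "tensor_null K M A #>\<^bsub>tensor_free M A\<^esub> c = tensor_null K M A #>\<^bsub>tensor_free M A\<^esub> d"
proof -
  interpret N: normal "tensor_null K M A" "tensor_free M A" by (rule tensor_null_normal[OF assms(1,2)])
  have "c = (c - d) \<otimes>\<^bsub>tensor_free M A\<^esub> d" by simp
  then have "c \<in> tensor_null K M A #>\<^bsub>tensor_free M A\<^esub> d"
    using assms(5) unfolding r_coset_def by blast
  then show ?thesis
    using N.repr_independence[OF _ assms(4) N.subgroup_axioms] by simp
qed

lemma tensor_relator_null: "c \<in> tensor_relators K M A \<Longrightarrow> c \<in> tensor_null K M A"
  unfolding tensor_null_def by (rule generate.incl)

text \<open>Each identity is one family of \<open>tensor_relators\<close> read modulo
  \<open>tensor_null\<close>: the difference of two representatives is a relator, so their cosets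
  agree.\<close>

lemma
  assumes M: "module K M" and A: "module K A" and x: "x \<in> carrier M" and a: "a \<in> carrier A"
  shows pure_tensor_add_left: "y \<in> carrier M \<Longrightarrow> pure_tensor K M A (x \<oplus>\<^bsub>M\<^esub> y) a
      = pure_tensor K M A x a \<oplus>\<^bsub>tensor_product K M A\<^esub> pure_tensor K M A y a" (is "_ \<Longrightarrow> ?l")
    and pure_tensor_add_right: "b \<in> carrier A \<Longrightarrow> pure_tensor K M A x (a \<oplus>\<^bsub>A\<^esub> b)
      = pure_tensor K M A x a \<oplus>\<^bsub>tensor_product K M A\<^esub> pure_tensor K M A x b" (is "_ \<Longrightarrow> ?r")
    and pure_tensor_balanced: "k \<in> carrier K \<Longrightarrow>
      pure_tensor K M A (k \<odot>\<^bsub>M\<^esub> x) a = pure_tensor K M A x (k \<odot>\<^bsub>A\<^esub> a)" (is "_ \<Longrightarrow> ?b")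
proof -
  interpret M: module K M by fact
  interpret A: module K A by fact
  interpret N: normal "tensor_null K M A" "tensor_free M A" by (rule tensor_null_normal[OF M A])
  note rel = tensor_relator_null[unfolded tensor_relators_def]
  have pure_add: "pure_tensor K M A p c \<oplus>\<^bsub>tensor_product K M A\<^esub> pure_tensor K M A q d
      = tensor_null K M A #>\<^bsub>tensor_free M A\<^esub> (frag_of (p, c) + frag_of (q, d))"
    if "p \<in> carrier M" "q \<in> carrier M" "c \<in> carrier A" "d \<in> carrier A" for p q c d
    using hom_mult[OF tensor_coset_hom[OF M A], of "frag_of (p, c)" "frag_of (q, d)"] that
    by (simp add: pure_tensor_def)
  have in_free: "frag_of (p, c) + frag_of (q, d) \<in> carrier (tensor_free M A)"
    if "p \<in> carrier M" "q \<in> carrier M" "c \<in> carrier A" "d \<in> carrier A" for p q c d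
    using that by (auto dest!: subsetD[OF keys_add] split: if_splits)
  show ?l if y: "y \<in> carrier M"
    unfolding pure_add[OF x y a a] unfolding pure_tensor_def
  proof (rule tensor_coset_eq[OF M A])
    show "frag_of (x \<oplus>\<^bsub>M\<^esub> y, a) - (frag_of (x, a) + frag_of (y, a)) \<in> tensor_null K M A"
      \<comment> \<open>The relators have the shape u - v - w, the goal the shape u - (v +
        w).\<close>
      unfolding diff_diff_eq[symmetric] by (rule rel) (use x y a in blast)
  qed (use x y a in_free in simp_all)
  show ?r if b: "b \<in> carrier A"
    unfolding pure_add[OF x x a b] unfolding pure_tensor_def
  proof (rule tensor_coset_eq[OF M A])
    show "frag_of (x, a \<oplus>\<^bsub>A\<^esub> b) - (frag_of (x, a) + frag_of (x, b)) \<in> tensor_null K M A"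
      unfolding diff_diff_eq[symmetric] by (rule rel) (use x b a in blast)
  qed (use x b a in_free in simp_all)
  show ?b if k: "k \<in> carrier K"
    unfolding pure_tensor_def
  proof (rule tensor_coset_eq[OF M A])
    show "frag_of (k \<odot>\<^bsub>M\<^esub> x, a) - frag_of (x, k \<odot>\<^bsub>A\<^esub> a) \<in> tensor_null K M A"
      by (rule rel) (use x a k in blast)
  qed (use x k a in simp_all)
qed

text \<open>Pure tensors are the cosets of the generators of the free abelian group. Composed with
  the quotient map, f and g become homomorphisms on that group, where agreement on generators
  spreads by induction along differences. This is the test by which later identities of additive
  maps on tensors are proved.\<close>

lemma tensor_hom_ext:
  assumes M: "module K M" and A: "module K A" and H: "abelian_group H"
    and f: "f \<in> add_hom (tensor_product K M A) H" and g: "g \<in> add_hom (tensor_product K M A) H"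
    and eq: "\<And>x a. x \<in> carrier M \<Longrightarrow> a \<in> carrier A \<Longrightarrow>
      f (pure_tensor K M A x a) = g (pure_tensor K M A x a)"
    and z: "z \<in> carrier (tensor_product K M A)"
  shows "f z = g z"
proof -
  let ?c = "\<lambda>c. tensor_null K M A #>\<^bsub>tensor_free M A\<^esub> c"
  interpret H: comm_group "add_monoid H" by (rule abelian_group.a_comm_group[OF H])
  interpret T: comm_group "add_monoid (tensor_product K M A)"
    by (rule abelian_group.a_comm_group[OF tensor_abelian_group[OF M A]])
  have c: "?c \<in> hom (tensor_free M A) (add_monoid (tensor_product K M A))"
    by (rule tensor_coset_hom[OF M A])
  have hom: "group_hom (tensor_free M A) (add_monoid H) (h \<circ> ?c)"
    if "h \<in> add_hom (tensor_product K M A) H" for h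
    using hom_compose[OF c that] by (simp add: group_hom_def group_hom_axioms_def)
  interpret f: group_hom "tensor_free M A" "add_monoid H" "f \<circ> ?c" by (rule hom[OF f])
  interpret g: group_hom "tensor_free M A" "add_monoid H" "g \<circ> ?c" by (rule hom[OF g])
  obtain c where c: "Poly_Mapping.keys c \<subseteq> carrier M \<times> carrier A" and z: "z = ?c c"
    using z by (auto simp: tensor_product_simps carrier_FactGroup)
  have "(f \<circ> ?c) c = (g \<circ> ?c) c"
    using c
  proof (rule free_Abelian_group_induct)
    show "(f \<circ> ?c) 0 = (g \<circ> ?c) 0" using f.hom_one g.hom_one by simp
  next
    fix x y
    assume xy: "Poly_Mapping.keys x \<subseteq> carrier M \<times> carrier A" "Poly_Mapping.keys y \<subseteq> carrier M \<times> carrier A"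
      and "(f \<circ> ?c) x = (g \<circ> ?c) x" "(f \<circ> ?c) y = (g \<circ> ?c) y"
    then show "(f \<circ> ?c) (x - y) = (g \<circ> ?c) (x - y)"
      using f.hom_mult[of x "- y"] g.hom_mult[of x "- y"] f.hom_inv[of y] g.hom_inv[of y] by simp
  next
    fix p
    assume "p \<in> carrier M \<times> carrier A"
    then show "(f \<circ> ?c) (frag_of p) = (g \<circ> ?c) (frag_of p)"
      using eq by (auto simp: pure_tensor_def)
  qed
  then show ?thesis using z by simp
qed

section \<open>Additive maps out of a tensor product\<close>

definition balanced ::
  "'k ring \<Rightarrow> ('k, 'm) module \<Rightarrow> ('k, 'a) module \<Rightarrow> ('g, 'r) ring_scheme \<Rightarrow> ('m \<Rightarrow> 'a \<Rightarrow> 'g) \<Rightarrow> bool" where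
  "balanced K M A G \<phi> \<longleftrightarrow>
     (\<forall>x \<in> carrier M. \<forall>a \<in> carrier A. \<phi> x a \<in> carrier G) \<and>
     (\<forall>x \<in> carrier M. \<forall>y \<in> carrier M. \<forall>a \<in> carrier A. \<phi> (x \<oplus>\<^bsub>M\<^esub> y) a = \<phi> x a \<oplus>\<^bsub>G\<^esub> \<phi> y a) \<and>
     (\<forall>x \<in> carrier M. \<forall>a \<in> carrier A. \<forall>b \<in> carrier A. \<phi> x (a \<oplus>\<^bsub>A\<^esub> b) = \<phi> x a \<oplus>\<^bsub>G\<^esub> \<phi> x b) \<and>
     (\<forall>k \<in> carrier K. \<forall>x \<in> carrier M. \<forall>a \<in> carrier A. \<phi> (k \<odot>\<^bsub>M\<^esub> x) a = \<phi> x (k \<odot>\<^bsub>A\<^esub> a))"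

text \<open>\<open>tensor_lift\<close> uses \<open>the_elem\<close>, so the defining sum has to be
  constant on cosets. The sum is a homomorphism h on the free group; it kills all relators because
  \<phi> is balanced, hence also the subgroup that they generate. Handing out h allows both the
  value on pure tensors and the additivity of the lift to be read off.\<close>

lemma tensor_lift_coset:
  assumes M: "module K M" and A: "module K A" and G: "abelian_group G" and \<phi>: "balanced K M A G \<phi>"
  obtains h where "h \<in> hom (tensor_free M A) (add_monoid G)"
    and "\<And>x a. x \<in> carrier M \<Longrightarrow> a \<in> carrier A \<Longrightarrow> h (frag_of (x, a)) = \<phi> x a"
    and "\<And>c. c \<in> carrier (tensor_free M A) \<Longrightarrow>
      tensor_lift G \<phi> (tensor_null K M A #>\<^bsub>tensor_free M A\<^esub> c) = h c"
proof -
  interpret M: module K M by fact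
  interpret A: module K A by fact
  interpret G: abelian_group G by fact
  interpret N: normal "tensor_null K M A" "tensor_free M A" by (rule tensor_null_normal[OF M A])
  let ?S = "carrier M \<times> carrier A"
  let ?t = "\<lambda>(c :: _ \<Rightarrow>\<^sub>0 int) p. [Poly_Mapping.lookup c p] \<cdot>\<^bsub>G\<^esub> \<phi> (fst p) (snd p)"
  define h where "h c = (\<Oplus>\<^bsub>G\<^esub>p \<in> Poly_Mapping.keys c. ?t c p)" for c
  have \<phi>_closed: "\<phi> x a \<in> carrier G" if "x \<in> carrier M" "a \<in> carrier A" for x a
    using \<phi> that by (simp add: balanced_def)
  have t_closed: "?t c p \<in> carrier G" if "p \<in> ?S" for c p
    using that \<phi>_closed by (auto intro: G.add.int_pow_closed)
  \<comment> \<open>The keys of c, of d and of c + d differ, as coefficients may cancel. Zero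
    coefficients contribute nothing, so all three sums can run over one larger finite set.\<close>
  have h_super: "h c = (\<Oplus>\<^bsub>G\<^esub>p \<in> S. ?t c p)"
    if "finite S" "Poly_Mapping.keys c \<subseteq> S" "S \<subseteq> ?S" for c S
    unfolding h_def
  proof (rule G.add.finprod_mono_neutral_cong_left[OF that(1,2)])
    show "?t c i = \<zero>\<^bsub>G\<^esub>" if "i \<in> S - Poly_Mapping.keys c" for i
      using that by (simp add: in_keys_iff add_pow_def)
    show "?t c \<in> S \<rightarrow> carrier G"
      using t_closed that(3) by blast
  qed simp
  have h: "h \<in> hom (tensor_free M A) (add_monoid G)"
  proof (rule homI)
    fix c d
    assume "c \<in> carrier (tensor_free M A)" "d \<in> carrier (tensor_free M A)"
    then have c: "Poly_Mapping.keys c \<subseteq> ?S" and d: "Poly_Mapping.keys d \<subseteq> ?S" by simp_all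
    show "h c \<in> carrier (add_monoid G)"
      unfolding h_def using t_closed c by (auto intro!: G.finsum_closed)
    let ?U = "Poly_Mapping.keys c \<union> Poly_Mapping.keys d"
    have U: "finite ?U" "?U \<subseteq> ?S" using c d by auto
    have "h (c + d) = (\<Oplus>\<^bsub>G\<^esub>p \<in> ?U. ?t (c + d) p)"
      by (rule h_super[OF U(1) _ U(2)]) (rule keys_add)
    also have "\<dots> = (\<Oplus>\<^bsub>G\<^esub>p \<in> ?U. ?t c p \<oplus>\<^bsub>G\<^esub> ?t d p)"
    proof (rule G.add.finprod_cong')
      show "(\<lambda>p. ?t c p \<oplus>\<^bsub>G\<^esub> ?t d p) \<in> ?U \<rightarrow> carrier G"
        using t_closed U(2) by (intro funcsetI G.a_closed) blast+
      show "?t (c + d) p = ?t c p \<oplus>\<^bsub>G\<^esub> ?t d p" if "p \<in> ?U" for p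
        using that U(2) \<phi>_closed by (auto simp: Poly_Mapping.lookup_add G.add.int_pow_mult)
    qed simp
    also have "\<dots> = (\<Oplus>\<^bsub>G\<^esub>p \<in> ?U. ?t c p) \<oplus>\<^bsub>G\<^esub> (\<Oplus>\<^bsub>G\<^esub>p \<in> ?U. ?t d p)"
      by (rule G.finsum_addf) (use t_closed U(2) in blast)+
    also have "\<dots> = h c \<oplus>\<^bsub>G\<^esub> h d"
      using h_super[OF U(1) _ U(2)] by simp
    finally show "h (c \<otimes>\<^bsub>tensor_free M A\<^esub> d) = h c \<otimes>\<^bsub>add_monoid G\<^esub> h d" by simp
  qed
  interpret h: group_hom "tensor_free M A" "add_monoid G" h
    using h G.a_group by (simp add: group_hom_def group_hom_axioms_def)
  have h_frag: "h (frag_of (x, a)) = \<phi> x a" if "x \<in> carrier M" "a \<in> carrier A" for x a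
    using \<phi>_closed[OF that] by (simp add: h_def G.add.int_pow_1)
  have h_diff: "h (c - d) = h c \<ominus>\<^bsub>G\<^esub> h d"
    if "c \<in> carrier (tensor_free M A)" "d \<in> carrier (tensor_free M A)" for c d
    using h.hom_mult[of c "- d"] h.hom_inv[of d] that by (simp add: a_minus_def a_inv_def)
  have add_free: "c - d \<in> carrier (tensor_free M A)"
    if "c \<in> carrier (tensor_free M A)" "d \<in> carrier (tensor_free M A)" for c d
    using that keys_diff[of c d] by auto
  \<comment> \<open>By additivity h sends a relator of either of the first two kinds to a term of
    this form.\<close>
  have cancel: "u \<oplus>\<^bsub>G\<^esub> v \<ominus>\<^bsub>G\<^esub> u \<ominus>\<^bsub>G\<^esub> v = \<zero>\<^bsub>G\<^esub>" if "u \<in> carrier G" "v \<in> carrier G" for u v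
  proof -
    have "u \<oplus>\<^bsub>G\<^esub> v \<ominus>\<^bsub>G\<^esub> u \<ominus>\<^bsub>G\<^esub> v = (u \<oplus>\<^bsub>G\<^esub> v) \<oplus>\<^bsub>G\<^esub> (\<ominus>\<^bsub>G\<^esub> (u \<oplus>\<^bsub>G\<^esub> v))"
      using that by (simp add: a_minus_def G.minus_add G.a_assoc)
    then show ?thesis using that by (simp add: G.r_neg)
  qed
  have rel: "h r = \<zero>\<^bsub>G\<^esub>" if r: "r \<in> tensor_relators K M A" for r
  proof -
    consider x y a where "r = frag_of (x \<oplus>\<^bsub>M\<^esub> y, a) - frag_of (x, a) - frag_of (y, a)"
        "x \<in> carrier M" "y \<in> carrier M" "a \<in> carrier A"
      | x a b where "r = frag_of (x, a \<oplus>\<^bsub>A\<^esub> b) - frag_of (x, a) - frag_of (x, b)"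
        "x \<in> carrier M" "a \<in> carrier A" "b \<in> carrier A"
      | k x a where "r = frag_of (k \<odot>\<^bsub>M\<^esub> x, a) - frag_of (x, k \<odot>\<^bsub>A\<^esub> a)"
        "k \<in> carrier K" "x \<in> carrier M" "a \<in> carrier A"
      using r unfolding tensor_relators_def by blast
    then show ?thesis
    proof cases
      case 1
      then have "\<phi> (x \<oplus>\<^bsub>M\<^esub> y) a = \<phi> x a \<oplus>\<^bsub>G\<^esub> \<phi> y a" using \<phi> by (simp add: balanced_def)
      with 1 show ?thesis
        by (simp add: h_diff add_free h_frag \<phi>_closed cancel del: carrier_free_Abelian_group_iff)
    next
      case 2
      then have "\<phi> x (a \<oplus>\<^bsub>A\<^esub> b) = \<phi> x a \<oplus>\<^bsub>G\<^esub> \<phi> x b" using \<phi> by (simp add: balanced_def)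
      with 2 show ?thesis
        by (simp add: h_diff add_free h_frag \<phi>_closed cancel del: carrier_free_Abelian_group_iff)
    next
      case 3
      then have "\<phi> (k \<odot>\<^bsub>M\<^esub> x) a = \<phi> x (k \<odot>\<^bsub>A\<^esub> a)" using \<phi> by (simp add: balanced_def)
      with 3 show ?thesis
        by (simp add: h_diff h_frag \<phi>_closed G.r_neg a_minus_def del: carrier_free_Abelian_group_iff)
    qed
  qed
  \<comment> \<open>A kernel is a subgroup, so it contains everything that the relators
    generate.\<close>
  have "tensor_null K M A \<subseteq> kernel (tensor_free M A) (add_monoid G) h"
    unfolding tensor_null_def
    by (rule group.generate_subgroup_incl[OF group_free_Abelian_group _ h.subgroup_kernel])
      (use rel tensor_relators_subset[OF M A] in \<open>auto simp: kernel_def simp del: carrier_free_Abelian_group_iff\<close>)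
  then have null: "h n = \<zero>\<^bsub>G\<^esub>" "n \<in> carrier (tensor_free M A)" if "n \<in> tensor_null K M A" for n
    using that by (auto simp: kernel_def)
  have "tensor_lift G \<phi> (tensor_null K M A #>\<^bsub>tensor_free M A\<^esub> c) = h c"
    if c: "c \<in> carrier (tensor_free M A)" for c
  proof -
    have "h (n + c) = h c" if "n \<in> tensor_null K M A" for n
      using h.hom_mult[OF null(2)[OF that] c] null(1)[OF that] h.hom_closed[OF c] by simp
    then have "h d = h c" if "d \<in> tensor_null K M A #>\<^bsub>tensor_free M A\<^esub> c" for d
      using that by (auto simp: r_coset_def)
    \<comment> \<open>Nonemptiness of the coset: its image is the singleton of \<open>h c\<close>
      and not the empty set.\<close>
    moreover have "c \<in> tensor_null K M A #>\<^bsub>tensor_free M A\<^esub> c"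
      by (rule N.rcos_self[OF c N.subgroup_axioms])
    ultimately have "h ` (tensor_null K M A #>\<^bsub>tensor_free M A\<^esub> c) = {h c}" by blast
    then show ?thesis by (simp add: tensor_lift_def h_def)
  qed
  with h h_frag show ?thesis by (rule that)
qed

lemma tensor_lift_pure:
  assumes "module K M" "module K A" "abelian_group G" "balanced K M A G \<phi>"
    and "x \<in> carrier M" "a \<in> carrier A"
  shows "tensor_lift G \<phi> (pure_tensor K M A x a) = \<phi> x a"
  using assms(5,6) unfolding pure_tensor_def
  by (rule_tac tensor_lift_coset[OF assms(1-4)]) simp

lemma tensor_lift_hom:
  assumes M: "module K M" and A: "module K A" and G: "abelian_group G" and \<phi>: "balanced K M A G \<phi>"
  shows "tensor_lift G \<phi> \<in> add_hom (tensor_product K M A) G"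
proof -
  let ?c = "\<lambda>c. tensor_null K M A #>\<^bsub>tensor_free M A\<^esub> c"
  obtain h where h: "h \<in> hom (tensor_free M A) (add_monoid G)"
    and lift: "\<And>c. c \<in> carrier (tensor_free M A) \<Longrightarrow> tensor_lift G \<phi> (?c c) = h c"
    by (rule tensor_lift_coset[OF assms]) blast
  have rep: "\<exists>c \<in> carrier (tensor_free M A). z = ?c c"
    if "z \<in> carrier (tensor_product K M A)" for z
    using that by (auto simp: tensor_product_simps carrier_FactGroup)
  have add_free: "c + d \<in> carrier (tensor_free M A)"
    if "c \<in> carrier (tensor_free M A)" "d \<in> carrier (tensor_free M A)" for c d
    using that keys_add[of c d] by auto
  show ?thesis
  proof (rule add_homI)
    fix z w
    assume "z \<in> carrier (tensor_product K M A)" "w \<in> carrier (tensor_product K M A)"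
    then obtain c d where c: "c \<in> carrier (tensor_free M A)" "z = ?c c"
      and d: "d \<in> carrier (tensor_free M A)" "w = ?c d" using rep by blast
    show "tensor_lift G \<phi> z \<in> carrier G"
      using c lift hom_in_carrier[OF h] by auto
    have "z \<oplus>\<^bsub>tensor_product K M A\<^esub> w = ?c (c + d)"
      using hom_mult[OF tensor_coset_hom[OF M A] c(1) d(1)] c d by simp
    then show "tensor_lift G \<phi> (z \<oplus>\<^bsub>tensor_product K M A\<^esub> w)
        = tensor_lift G \<phi> z \<oplus>\<^bsub>G\<^esub> tensor_lift G \<phi> w"
      using lift[OF add_free[OF c(1) d(1)]] lift[OF c(1)] lift[OF d(1)] hom_mult[OF h c(1) d(1)] c(2) d(2)
      by simp
  qed
qed

section \<open>Functoriality of the tensor product\<close>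

lemma balanced_pure_tensor:
  assumes "module K N" "module K B" "f \<in> module_hom K M N" "g \<in> module_hom K A B"
  shows "balanced K M A (tensor_product K N B) (\<lambda>x a. pure_tensor K N B (f x) (g a))"
  unfolding balanced_def using assms
  by (simp add: module_hom_closed module_hom_add module_hom_smult pure_tensor_closed
      pure_tensor_add_left pure_tensor_add_right pure_tensor_balanced)

lemma tensor_map_pure:
  assumes "module K M" "module K A" "module K N" "module K B"
    and "f \<in> module_hom K M N" "g \<in> module_hom K A B" "x \<in> carrier M" "a \<in> carrier A"
  shows "tensor_map K N B f g (pure_tensor K M A x a) = pure_tensor K N B (f x) (g a)"
  unfolding tensor_map_def
  using tensor_lift_pure[OF assms(1,2) tensor_abelian_group[OF assms(3,4)] balanced_pure_tensor] assms
  by blast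

text \<open>The map g on the second factor only has to be K-linear. This admits the shift of
  coefficients and multiplication by a fixed element, which are not ring homomorphisms in
  general.\<close>

lemma tensor_map_hom:
  assumes "module K M" "module K A" "module K N" "module K B"
    and "f \<in> module_hom K M N" "g \<in> module_hom K A B"
  shows "tensor_map K N B f g \<in> add_hom (tensor_product K M A) (tensor_product K N B)"
  unfolding tensor_map_def
  using tensor_lift_hom[OF assms(1,2) tensor_abelian_group[OF assms(3,4)] balanced_pure_tensor] assms
  by blast

lemma tensor_map_closed:
  assumes "module K M" "module K A" "module K N" "module K B"
    and "f \<in> module_hom K M N" "g \<in> module_hom K A B" "z \<in> carrier (tensor_product K M A)"
  shows "tensor_map K N B f g z \<in> carrier (tensor_product K N B)"
  using add_hom_closed[OF tensor_map_hom] assms by blast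

lemma tensor_map_add:
  assumes "module K M" "module K A" "module K N" "module K B"
    and "f \<in> module_hom K M N" "g \<in> module_hom K A B"
    and "z \<in> carrier (tensor_product K M A)" "w \<in> carrier (tensor_product K M A)"
  shows "tensor_map K N B f g (z \<oplus>\<^bsub>tensor_product K M A\<^esub> w)
    = tensor_map K N B f g z \<oplus>\<^bsub>tensor_product K N B\<^esub> tensor_map K N B f g w"
  using add_hom_add[OF tensor_map_hom] assms by blast

text \<open>\<open>module_hom\<close> constrains a map on the carrier only, so maps that agree there
  can be different functions, and their tensors have to be compared by this rule.\<close>

lemma tensor_map_cong:
  assumes M: "module K M" "module K A" "module K N" "module K B"
    and f: "f \<in> module_hom K M N" "g \<in> module_hom K A B"
    and f': "f' \<in> module_hom K M N" "g' \<in> module_hom K A B"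
    and "\<And>x. x \<in> carrier M \<Longrightarrow> f x = f' x" "\<And>a. a \<in> carrier A \<Longrightarrow> g a = g' a"
    and z: "z \<in> carrier (tensor_product K M A)"
  shows "tensor_map K N B f g z = tensor_map K N B f' g' z"
  using z
  by (rule tensor_hom_ext[OF M(1,2) tensor_abelian_group[OF M(3,4)]
        tensor_map_hom[OF M f] tensor_map_hom[OF M f'], rotated])
    (use assms in \<open>simp add: tensor_map_pure[OF M f] tensor_map_pure[OF M f']\<close>)

lemma add_hom_compose: "f \<in> add_hom G H \<Longrightarrow> g \<in> add_hom H I \<Longrightarrow> (\<lambda>x. g (f x)) \<in> add_hom G I"
  by (rule add_homI) (simp_all add: add_hom_closed add_hom_add)

lemma tensor_map_compose:
  assumes M: "module K M" "module K A" and N: "module K N" "module K B" and P: "module K P" "module K C"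
    and f: "f \<in> module_hom K M N" "g \<in> module_hom K A B"
    and f': "f' \<in> module_hom K N P" "g' \<in> module_hom K B C"
    and z: "z \<in> carrier (tensor_product K M A)"
  shows "tensor_map K P C f' g' (tensor_map K N B f g z) = tensor_map K P C (f' \<circ> f) (g' \<circ> g) z"
  using z
  by (rule tensor_hom_ext[OF M tensor_abelian_group[OF P] add_hom_compose[OF tensor_map_hom[OF M N f]
        tensor_map_hom[OF N P f']] tensor_map_hom[OF M P module_hom_compose[OF f(1) f'(1)]
        module_hom_compose[OF f(2) f'(2)]], rotated])
    (simp add: tensor_map_pure[OF M N f] tensor_map_pure[OF N P f'] module_hom_closed[OF f(1)] module_hom_closed[OF f(2)]
      tensor_map_pure[OF M P module_hom_compose[OF f(1) f'(1)] module_hom_compose[OF f(2) f'(2)]])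

lemma tensor_map_id:
  assumes M: "module K M" "module K A" and z: "z \<in> carrier (tensor_product K M A)"
  shows "tensor_map K M A id id z = z"
  using z
  by (rule tensor_hom_ext[where g = "\<lambda>z. z", OF M tensor_abelian_group[OF M]
        tensor_map_hom[OF M M module_hom_id module_hom_id], rotated 2])
    (simp_all add: tensor_map_pure[OF M M module_hom_id module_hom_id] hom_def)

lemma add_hom_sum:
  assumes "abelian_group H" "f \<in> add_hom G H" "g \<in> add_hom G H"
  shows "(\<lambda>x. f x \<oplus>\<^bsub>H\<^esub> g x) \<in> add_hom G H"
proof -
  interpret H: abelian_group H by fact
  show ?thesis
    by (rule add_homI) (use assms(2,3) in \<open>simp_all add: add_hom_closed add_hom_add H.a_ac\<close>)
qed

text \<open>It is this additivity in the second factor that carries the splitting of a polynomial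
  into its constant term and a multiple of T over to M \<otimes> A[T].\<close>

lemma tensor_map_sum_right:
  assumes M: "module K M" "module K A" and N: "module K N" "module K B"
    and f: "f \<in> module_hom K M N"
    and g: "g \<in> module_hom K A B" "g' \<in> module_hom K A B" "g'' \<in> module_hom K A B"
    and eq: "\<And>x. x \<in> carrier A \<Longrightarrow> g'' x = g x \<oplus>\<^bsub>B\<^esub> g' x"
    and z: "z \<in> carrier (tensor_product K M A)"
  shows "tensor_map K N B f g'' z
    = tensor_map K N B f g z \<oplus>\<^bsub>tensor_product K N B\<^esub> tensor_map K N B f g' z"
  using z
  by (rule tensor_hom_ext[OF M tensor_abelian_group[OF N] tensor_map_hom[OF M N f g(3)]
        add_hom_sum[OF tensor_abelian_group[OF N] tensor_map_hom[OF M N f g(1)]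
          tensor_map_hom[OF M N f g(2)]], rotated])
    (simp add: tensor_map_pure[OF M N f g(1)] tensor_map_pure[OF M N f g(2)]
      tensor_map_pure[OF M N f g(3)] eq pure_tensor_add_right N module_hom_closed[OF f]
      module_hom_closed[OF g(1)] module_hom_closed[OF g(2)])

text \<open>Since 0 + 0 = 0 in B, additivity in the second factor gives e = e + e for the image e,
  and e cancels.\<close>

lemma tensor_map_zero:
  assumes M: "module K M" "module K A" and N: "module K N" "module K B"
    and f: "f \<in> module_hom K M N"
    and z: "z \<in> carrier (tensor_product K M A)"
  shows "tensor_map K N B f (\<lambda>_. \<zero>\<^bsub>B\<^esub>) z = \<zero>\<^bsub>tensor_product K N B\<^esub>"
proof -
  interpret B: module K B by fact
  interpret T: abelian_group "tensor_product K N B" by (rule tensor_abelian_group[OF N])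
  have 0: "(\<lambda>_. \<zero>\<^bsub>B\<^esub>) \<in> module_hom K A B" by (rule module_homI) auto
  note c = tensor_map_closed[OF M N f 0 z]
  from tensor_map_sum_right[OF M N f 0 0 0 _ z]
  have "tensor_map K N B f (\<lambda>_. \<zero>\<^bsub>B\<^esub>) z = tensor_map K N B f (\<lambda>_. \<zero>\<^bsub>B\<^esub>) z \<oplus>\<^bsub>tensor_product K N B\<^esub> tensor_map K N B f (\<lambda>_. \<zero>\<^bsub>B\<^esub>) z"
    by simp
  with c show ?thesis using T.add.l_cancel_one' by metis
qed

section \<open>Algebras and polynomials\<close>

lemma algebra_is_module: "algebra K A \<Longrightarrow> module K A"
  by (rule algebra.module)

lemma algebra_is_cring: "algebra K A \<Longrightarrow> cring A"
  by (rule algebra.M_cring)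

lemma algebra_hom_ring_hom: "\<phi> \<in> algebra_hom K A B \<Longrightarrow> \<phi> \<in> ring_hom A B"
  by (simp add: algebra_hom_def)

lemma algebra_hom_module_hom: "\<phi> \<in> algebra_hom K A B \<Longrightarrow> \<phi> \<in> module_hom K A B"
  by (auto simp: algebra_hom_def ring_hom_def intro: module_homI)

lemma algebra_homI:
  assumes "\<phi> \<in> ring_hom A B"
    and "\<And>k a. k \<in> carrier K \<Longrightarrow> a \<in> carrier A \<Longrightarrow> \<phi> (k \<odot>\<^bsub>A\<^esub> a) = k \<odot>\<^bsub>B\<^esub> \<phi> a"
  shows "\<phi> \<in> algebra_hom K A B"
  using assms by (simp add: algebra_hom_def)

lemma algebra_hom_mult:
  "\<phi> \<in> algebra_hom K A B \<Longrightarrow> a \<in> carrier A \<Longrightarrow> b \<in> carrier A \<Longrightarrow>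
    \<phi> (a \<otimes>\<^bsub>A\<^esub> b) = \<phi> a \<otimes>\<^bsub>B\<^esub> \<phi> b"
  by (auto simp: algebra_hom_def ring_hom_def)

text \<open>Brings \<open>tensor_scale\<close> under the rules for \<open>tensor_map\<close>.
  Scalars of K pass through the product because A is commutative.\<close>

lemma mult_module_hom:
  assumes "algebra K A" "a \<in> carrier A"
  shows "(\<lambda>b. a \<otimes>\<^bsub>A\<^esub> b) \<in> module_hom K A A"
proof -
  interpret A: algebra K A by fact
  have "k \<odot>\<^bsub>A\<^esub> a \<otimes>\<^bsub>A\<^esub> b = a \<otimes>\<^bsub>A\<^esub> (k \<odot>\<^bsub>A\<^esub> b)" if "k \<in> carrier K" "b \<in> carrier A" for k b
    using A.smult_assoc2[OF that(1) that(2) assms(2)] A.smult_assoc2[OF that(1) assms(2) that(2)] that assms(2)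
    by (simp add: A.m_comm)
  then show ?thesis
    by (intro module_homI) (use assms in \<open>simp_all add: A.r_distr A.smult_assoc2\<close>)
qed

lemma base_algebra_algebra:
  assumes "cring K"
  shows "algebra K (base_algebra K)"
proof -
  interpret K: cring K by fact
  have neg: "\<exists>y\<in>carrier K. y \<oplus>\<^bsub>K\<^esub> x = \<zero>\<^bsub>K\<^esub>" if "x \<in> carrier K" for x
    using that K.l_neg by blast
  show ?thesis
    by (rule algebraI, rule K.is_cring,
        rule cringI, rule abelian_groupI)
      (auto simp: base_algebra_def K.m_ac K.a_ac K.l_distr K.r_distr neg
        intro!: comm_monoidI)
qed

section \<open>Arithmetic of polynomials as coefficient sequences\<close>

lemma UP_simps:
  "carrier (UP R) = up R"
  "p \<in> up R \<Longrightarrow> q \<in> up R \<Longrightarrow> p \<oplus>\<^bsub>UP R\<^esub> q = (\<lambda>i. p i \<oplus>\<^bsub>R\<^esub> q i)"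
  "p \<in> up R \<Longrightarrow> q \<in> up R \<Longrightarrow> p \<otimes>\<^bsub>UP R\<^esub> q = (\<lambda>n. \<Oplus>\<^bsub>R\<^esub>i \<in> {..n}. p i \<otimes>\<^bsub>R\<^esub> q (n - i))"
  "\<one>\<^bsub>UP R\<^esub> = (\<lambda>i. if i = 0 then \<one>\<^bsub>R\<^esub> else \<zero>\<^bsub>R\<^esub>)"
  "\<zero>\<^bsub>UP R\<^esub> = (\<lambda>i. \<zero>\<^bsub>R\<^esub>)"
  "a \<in> carrier R \<Longrightarrow> up_ring.monom (UP R) a n = (\<lambda>i. if i = n then a else \<zero>\<^bsub>R\<^esub>)"
  "p \<in> up R \<Longrightarrow> up_ring.coeff (UP R) p n = p n"
  by (simp_all add: UP_def)

lemma poly_algebra_simps: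
  "carrier (poly_algebra A) = Seq ` up A"
  "\<zero>\<^bsub>poly_algebra A\<^esub> = Seq (\<lambda>i. \<zero>\<^bsub>A\<^esub>)"
  "\<one>\<^bsub>poly_algebra A\<^esub> = Seq (\<lambda>i. if i = 0 then \<one>\<^bsub>A\<^esub> else \<zero>\<^bsub>A\<^esub>)"
  "p \<in> up A \<Longrightarrow> q \<in> up A \<Longrightarrow> Seq p \<oplus>\<^bsub>poly_algebra A\<^esub> Seq q = Seq (\<lambda>i. p i \<oplus>\<^bsub>A\<^esub> q i)"
  "p \<in> up A \<Longrightarrow> q \<in> up A \<Longrightarrow>
    Seq p \<otimes>\<^bsub>poly_algebra A\<^esub> Seq q = Seq (\<lambda>n. \<Oplus>\<^bsub>A\<^esub>i \<in> {..n}. p i \<otimes>\<^bsub>A\<^esub> q (n - i))"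
  "k \<odot>\<^bsub>poly_algebra A\<^esub> Seq p = Seq (\<lambda>i. k \<odot>\<^bsub>A\<^esub> p i)"
  by (simp_all add: poly_algebra_def UP_simps)

text \<open>A second reading of the operations, next to the formulas in coefficients: free of
  membership conditions, it lets the ring axioms be inherited from \<open>UP\<close>.\<close>

lemma poly_algebra_UP:
  "Seq p \<otimes>\<^bsub>poly_algebra A\<^esub> Seq q = Seq (p \<otimes>\<^bsub>UP A\<^esub> q)"
  "Seq p \<oplus>\<^bsub>poly_algebra A\<^esub> Seq q = Seq (p \<oplus>\<^bsub>UP A\<^esub> q)"
  "\<one>\<^bsub>poly_algebra A\<^esub> = Seq \<one>\<^bsub>UP A\<^esub>" "\<zero>\<^bsub>poly_algebra A\<^esub> = Seq \<zero>\<^bsub>UP A\<^esub>"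
  "carrier (poly_algebra A) = Seq ` carrier (UP A)"
  by (simp_all add: poly_algebra_def)

text \<open>Zero goes to zero, so a bound on the degree of p also bounds the degree of the
  image.\<close>

lemma up_map:
  assumes "p \<in> up A" "\<And>a. a \<in> carrier A \<Longrightarrow> f a \<in> carrier B" "f \<zero>\<^bsub>A\<^esub> = \<zero>\<^bsub>B\<^esub>"
  shows "(\<lambda>i. f (p i)) \<in> up B"
  using assms unfolding up_def bound_def by fastforce

lemma up_shift: "p \<in> up A \<Longrightarrow> (\<lambda>i. p (Suc i)) \<in> up A"
  unfolding up_def bound_def by (auto simp: Pi_def) (metis less_SucI)

lemma up_const:
  assumes "cring A" "a \<in> carrier A"
  shows "(\<lambda>i. if i = n then a else \<zero>\<^bsub>A\<^esub>) \<in> up A"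
proof -
  interpret cring A by fact
  show ?thesis using assms(2) unfolding up_def bound_def by auto
qed

lemma poly_algebra_algebra:
  assumes "algebra K A"
  shows "algebra K (poly_algebra A)"
proof -
  interpret A: algebra K A by fact
  interpret U: UP_cring A "UP A" by unfold_locales simp
  have smult: "(\<lambda>i. k \<odot>\<^bsub>A\<^esub> p i) \<in> up A" if "k \<in> carrier K" "p \<in> up A" for k p
    by (rule up_map[OF that(2)]) (use that in auto)
  have C: "cring (poly_algebra A)"
  proof (rule cringI)
    show "abelian_group (poly_algebra A)"
      by (rule abelian_groupI)
        (auto simp: poly_algebra_UP U.P.a_ac U.UP_l_neg_ex)
    show "comm_monoid (poly_algebra A)"
      by (rule comm_monoidI) (auto simp: poly_algebra_UP U.P.m_ac)
  qed (auto simp: poly_algebra_UP U.P.l_distr)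
  \<comment> \<open>The library ring carries scalars from A only, so the axioms for the action of K
    are checked on coefficients.\<close>
  show ?thesis
  proof (rule algebraI[OF A.R_cring C])
    fix k x y
    assume k: "k \<in> carrier K" and x: "x \<in> carrier (poly_algebra A)" and y: "y \<in> carrier (poly_algebra A)"
    then obtain p q where p: "p \<in> up A" "x = Seq p" and q: "q \<in> up A" "y = Seq q"
      by (auto simp: poly_algebra_simps)
    note up = mem_upD[OF p(1)] mem_upD[OF q(1)]
    show "k \<odot>\<^bsub>poly_algebra A\<^esub> x \<otimes>\<^bsub>poly_algebra A\<^esub> y
        = k \<odot>\<^bsub>poly_algebra A\<^esub> (x \<otimes>\<^bsub>poly_algebra A\<^esub> y)"
      using k p q smult up
      by (simp add: poly_algebra_simps A.smult_assoc2 A.finsum_smult_ldistr cong: A.M.finsum_cong)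
    show "k \<odot>\<^bsub>poly_algebra A\<^esub> (x \<oplus>\<^bsub>poly_algebra A\<^esub> y)
        = k \<odot>\<^bsub>poly_algebra A\<^esub> x \<oplus>\<^bsub>poly_algebra A\<^esub> k \<odot>\<^bsub>poly_algebra A\<^esub> y"
      using k p q smult up by (simp add: poly_algebra_simps A.smult_r_distr)
  qed (auto simp: poly_algebra_simps smult A.smult_l_distr A.smult_assoc1 mem_upD)
qed

lemma poly_const_Seq:
  "a \<in> carrier A \<Longrightarrow> poly_const A a = Seq (\<lambda>i. if i = 0 then a else \<zero>\<^bsub>A\<^esub>)"
  by (simp add: poly_const_def UP_simps)

lemma poly_const_hom:
  assumes "algebra K A"
  shows "poly_const A \<in> algebra_hom K A (poly_algebra A)"
proof -
  interpret A: algebra K A by fact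
  interpret U: UP_cring A "UP A" by unfold_locales simp
  note up = up_const[OF algebra_is_cring[OF assms]]
  show ?thesis
  proof (rule algebra_homI)
    show "poly_const A \<in> ring_hom A (poly_algebra A)"
      using U.const_ring_hom
      by (auto simp: ring_hom_def poly_const_def poly_algebra_UP Pi_def)
    show "poly_const A (k \<odot>\<^bsub>A\<^esub> a) = k \<odot>\<^bsub>poly_algebra A\<^esub> poly_const A a"
      if "k \<in> carrier K" "a \<in> carrier A" for k a
      using that by (simp add: poly_const_Seq poly_algebra_simps) auto
  qed
qed

lemma poly_var_closed: "algebra K A \<Longrightarrow> poly_var A \<in> carrier (poly_algebra A)"
  using up_const[OF algebra_is_cring, of K A "\<one>\<^bsub>A\<^esub>" 1]
  by (auto simp: poly_var_def poly_algebra_simps UP_simps algebra_is_cring cring.cring_simprules(6))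

text \<open>Stated in coefficients so that the shift visibly undoes multiplication by T. In place 0
  the convolution has a single term, and its factor from T vanishes.\<close>

lemma poly_var_mult:
  assumes "algebra K A" "p \<in> up A"
  shows "poly_var A \<otimes>\<^bsub>poly_algebra A\<^esub> Seq p
    = Seq (\<lambda>n. case n of 0 \<Rightarrow> \<zero>\<^bsub>A\<^esub> | Suc m \<Rightarrow> p m)"
proof -
  interpret A: algebra K A by fact
  interpret U: UP_cring A "UP A" by unfold_locales simp
  have p: "p \<in> carrier (UP A)" using assms(2) by (simp add: UP_simps)
  have m: "up_ring.monom (UP A) \<one>\<^bsub>A\<^esub> 1 \<in> carrier (UP A)" by simp
  have c: "up_ring.coeff (UP A) q n = q n" if "q \<in> carrier (UP A)" for q n
    using that by (simp add: UP_simps)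
  let ?q = "up_ring.monom (UP A) \<one>\<^bsub>A\<^esub> 1 \<otimes>\<^bsub>UP A\<^esub> p"
  have q: "?q \<in> carrier (UP A)" using m p by (rule U.P.m_closed)
  have "?q n = (case n of 0 \<Rightarrow> \<zero>\<^bsub>A\<^esub> | Suc m \<Rightarrow> p m)" for n
  proof (cases n)
    case 0
    then show ?thesis
      using U.coeff_mult[OF m p, of 0] c[OF q] c[OF p] mem_upD[OF assms(2)] by simp
  next
    case (Suc k)
    then show ?thesis
      using U.coeff_monom_mult[OF A.one_closed p, of 1 k] c[OF q] c[OF p] mem_upD[OF assms(2)] by simp
  qed
  then show ?thesis by (auto simp: poly_var_def poly_algebra_UP)
qed

text \<open>\<open>UnivPoly.eval\<close> is a ring homomorphism fixing constants and knows nothing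
  of K. Its K-linearity follows because k acts on A[T] as multiplication by the constant polynomial
  k1.\<close>

lemma poly_eval_hom:
  assumes "algebra K A" "t \<in> carrier A"
  shows "poly_eval A t \<in> algebra_hom K (poly_algebra A) A"
    and "a \<in> carrier A \<Longrightarrow> poly_eval A t (poly_const A a) = a"
    and "poly_eval A t (poly_var A) = t"
proof -
  interpret A: algebra K A by fact
  interpret U: UP_pre_univ_prop A A id "UP A"
    by (rule UP_pre_univ_propI) (auto intro: A.M_cring id_ring_hom)
  have hom: "UnivPoly.eval A A id t \<in> ring_hom (UP A) A" by (rule U.eval_ring_hom[OF assms(2)])
  show const: "poly_eval A t (poly_const A a) = a" if "a \<in> carrier A" for a
    using U.eval_const[OF assms(2) that] by (simp add: poly_eval_def poly_const_def)
  show "poly_eval A t (poly_var A) = t"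
    using U.eval_monom1[OF assms(2)] by (simp add: poly_eval_def poly_var_def)
  have ring: "poly_eval A t \<in> ring_hom (poly_algebra A) A"
    using hom by (auto simp: ring_hom_def poly_eval_def poly_algebra_UP Pi_def)
  interpret P: algebra K "poly_algebra A" by (rule poly_algebra_algebra[OF assms(1)])
  note pc = poly_const_hom[OF assms(1)]
  show "poly_eval A t \<in> algebra_hom K (poly_algebra A) A"
  proof (rule algebra_homI[OF ring])
    fix k p
    assume k: "k \<in> carrier K" and p: "p \<in> carrier (poly_algebra A)"
    have kc: "k \<odot>\<^bsub>A\<^esub> \<one>\<^bsub>A\<^esub> \<in> carrier A" using k by simp
    have one: "poly_const A \<one>\<^bsub>A\<^esub> = \<one>\<^bsub>poly_algebra A\<^esub>"
      using algebra_hom_ring_hom[OF pc] by (simp add: ring_hom_def)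
    have "k \<odot>\<^bsub>poly_algebra A\<^esub> p = poly_const A (k \<odot>\<^bsub>A\<^esub> \<one>\<^bsub>A\<^esub>) \<otimes>\<^bsub>poly_algebra A\<^esub> p"
      using k p module_hom_smult[OF algebra_hom_module_hom[OF pc] k A.one_closed]
      by (simp add: one P.smult_assoc2)
    then have "poly_eval A t (k \<odot>\<^bsub>poly_algebra A\<^esub> p)
        = poly_eval A t (poly_const A (k \<odot>\<^bsub>A\<^esub> \<one>\<^bsub>A\<^esub>)) \<otimes>\<^bsub>A\<^esub> poly_eval A t p"
      using ring_hom_mult[OF ring _ p] module_hom_closed[OF algebra_hom_module_hom[OF pc] kc] by simp
    also have "\<dots> = k \<odot>\<^bsub>A\<^esub> poly_eval A t p"
      using const[OF kc] k ring_hom_closed[OF ring p] by (simp add: A.smult_assoc2)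
    finally show "poly_eval A t (k \<odot>\<^bsub>poly_algebra A\<^esub> p) = k \<odot>\<^bsub>A\<^esub> poly_eval A t p" .
  qed
qed

section \<open>Constant term and division by T in A[T]\<close>

lemma coeffs_zero_hom:
  assumes "algebra K A"
  shows "(\<lambda>p. coeffs p 0) \<in> algebra_hom K (poly_algebra A) A"
proof -
  interpret A: algebra K A by fact
  show ?thesis
    by (intro algebra_homI ring_hom_memI) (auto simp: poly_algebra_simps mem_upD)
qed

text \<open>The quotient under division by T. It is linear but in general not multiplicative, so it
  can be tensored with a module but not passed through a polynomial law.\<close>

definition poly_shift :: "('k, 'x) test \<Rightarrow> ('k, 'x) test" where
  "poly_shift p = Seq (\<lambda>i. coeffs p (Suc i))"

lemma poly_shift_hom: "poly_shift \<in> module_hom K (poly_algebra A) (poly_algebra A)"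
  by (rule module_homI) (auto simp: poly_shift_def poly_algebra_simps up_shift)

lemma poly_shift_const:
  "a \<in> carrier A \<Longrightarrow> poly_shift (poly_const A a) = \<zero>\<^bsub>poly_algebra A\<^esub>"
  by (simp add: poly_shift_def poly_const_Seq poly_algebra_simps)

lemma poly_shift_var_mult:
  "algebra K A \<Longrightarrow> p \<in> carrier (poly_algebra A) \<Longrightarrow>
    poly_shift (poly_var A \<otimes>\<^bsub>poly_algebra A\<^esub> p) = p"
  by (auto simp: poly_shift_def poly_algebra_simps poly_var_mult)

lemma poly_decomp:
  assumes "algebra K A" "p \<in> carrier (poly_algebra A)"
  shows "p = poly_const A (coeffs p 0)
    \<oplus>\<^bsub>poly_algebra A\<^esub> poly_var A \<otimes>\<^bsub>poly_algebra A\<^esub> poly_shift p"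
proof -
  interpret A: algebra K A by fact
  obtain q where q: "p = Seq q" "q \<in> up A" using assms(2) by (auto simp: poly_algebra_simps)
  note qc = mem_upD[OF q(2)]
  \<comment> \<open>This is T times the shifted polynomial. The formula for sums in
    \<open>poly_algebra\<close> requires both summands to lie in \<open>up A\<close>.\<close>
  have "(\<lambda>n. case n of 0 \<Rightarrow> \<zero>\<^bsub>A\<^esub> | Suc m \<Rightarrow> q (Suc m)) \<in> up A"
    using q(2) unfolding up_def bound_def by (auto simp: Pi_def split: nat.split)
  moreover have "(\<lambda>i. if i = 0 then q 0 else \<zero>\<^bsub>A\<^esub>) \<in> up A"
    by (rule up_const[OF A.M_cring qc])
  ultimately show ?thesis
    using q qc
    by (auto simp: poly_shift_def poly_var_mult[OF assms(1)] up_shift poly_const_Seq poly_algebra_simps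
        split: nat.split)
qed

text \<open>The difference quotient over A is computed in A[T], the one over B in B[T]; this map
  between the two is what naturality of the quotient needs.\<close>

definition poly_map :: "(('k, 'x) test \<Rightarrow> ('k, 'x) test) \<Rightarrow> ('k, 'x) test \<Rightarrow> ('k, 'x) test" where
  "poly_map \<phi> p = Seq (\<lambda>i. \<phi> (coeffs p i))"

context
  fixes K :: "'k ring" and A B :: "('k, 'x) test_algebra" and \<phi> :: "('k, 'x) test \<Rightarrow> ('k, 'x) test"
  assumes A: "algebra K A" and B: "algebra K B" and \<phi>: "\<phi> \<in> algebra_hom K A B"
begin

interpretation A: algebra K A by (rule A)
interpretation B: algebra K B by (rule B)
interpretation \<phi>: ring_hom_cring A B \<phi>
  by (rule ring_hom_cringI[OF A.M_cring B.M_cring algebra_hom_ring_hom[OF \<phi>]])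

lemma up_hom: "p \<in> up A \<Longrightarrow> (\<lambda>i. \<phi> (p i)) \<in> up B"
  by (rule up_map) auto

lemma poly_map_hom: "poly_map \<phi> \<in> algebra_hom K (poly_algebra A) (poly_algebra B)"
proof (intro algebra_homI ring_hom_memI)
  fix x y
  assume "x \<in> carrier (poly_algebra A)" "y \<in> carrier (poly_algebra A)"
  then obtain p q where p: "x = Seq p" "p \<in> up A" and q: "y = Seq q" "q \<in> up A"
    by (auto simp: poly_algebra_simps)
  note pq = mem_upD[OF p(2)] mem_upD[OF q(2)]
  show "poly_map \<phi> x \<in> carrier (poly_algebra B)"
    using p up_hom by (auto simp: poly_map_def poly_algebra_simps)
  show "poly_map \<phi> (x \<oplus>\<^bsub>poly_algebra A\<^esub> y) = poly_map \<phi> x \<oplus>\<^bsub>poly_algebra B\<^esub> poly_map \<phi> y"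
    using p q up_hom pq by (simp add: poly_map_def poly_algebra_simps)
  show "poly_map \<phi> (x \<otimes>\<^bsub>poly_algebra A\<^esub> y) = poly_map \<phi> x \<otimes>\<^bsub>poly_algebra B\<^esub> poly_map \<phi> y"
    using p q up_hom pq
    by (simp add: poly_map_def poly_algebra_simps Pi_def o_def)
next
  show "poly_map \<phi> \<one>\<^bsub>poly_algebra A\<^esub> = \<one>\<^bsub>poly_algebra B\<^esub>"
    by (auto simp: poly_map_def poly_algebra_simps)
next
  fix k x
  assume k: "k \<in> carrier K" and "x \<in> carrier (poly_algebra A)"
  then obtain p where "x = Seq p" "p \<in> up A" by (auto simp: poly_algebra_simps)
  then show "poly_map \<phi> (k \<odot>\<^bsub>poly_algebra A\<^esub> x) = k \<odot>\<^bsub>poly_algebra B\<^esub> poly_map \<phi> x"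
    using k module_hom_smult[OF algebra_hom_module_hom[OF \<phi>] k]
    by (simp add: poly_map_def poly_algebra_simps mem_upD)
qed

lemma poly_map_const: "a \<in> carrier A \<Longrightarrow> poly_map \<phi> (poly_const A a) = poly_const B (\<phi> a)"
  by (auto simp: poly_map_def poly_const_Seq)

lemma poly_map_var: "poly_map \<phi> (poly_var A) = poly_var B"
  by (auto simp: poly_map_def poly_var_def UP_simps)

lemma poly_map_shift: "poly_map \<phi> (poly_shift p) = poly_shift (poly_map \<phi> p)"
  by (simp add: poly_map_def poly_shift_def)

end

text \<open>\<open>UnivPoly.eval\<close> sums up to the degree, and a homomorphism may lower the
  degree. With an arbitrary bound n, a polynomial and its image can be summed over the same
  range.\<close>

lemma poly_eval_sum:
  assumes "algebra K A" "p \<in> up A" "t \<in> carrier A" and n: "\<And>m. n < m \<Longrightarrow> p m = \<zero>\<^bsub>A\<^esub>"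
  shows "poly_eval A t (Seq p) = (\<Oplus>\<^bsub>A\<^esub>i \<in> {..n}. p i \<otimes>\<^bsub>A\<^esub> t [^]\<^bsub>A\<^esub> i)"
proof -
  interpret A: algebra K A by fact
  interpret U: UP_cring A "UP A" by unfold_locales simp
  have p: "p \<in> carrier (UP A)" using assms(2) by (simp add: UP_simps)
  have d: "deg A p \<le> n" using n by (intro U.deg_aboveI[OF _ p]) (simp add: UP_simps assms(2))
  have 0: "p m = \<zero>\<^bsub>A\<^esub>" if "deg A p < m" for m
    using U.deg_aboveD[OF that p] by (simp add: UP_simps assms(2))
  have "poly_eval A t (Seq p) = (\<Oplus>\<^bsub>A\<^esub>i \<in> {..deg A p}. p i \<otimes>\<^bsub>A\<^esub> t [^]\<^bsub>A\<^esub> i)"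
    using U.eval_on_carrier[OF p, of A id t] by (simp add: poly_eval_def UP_simps assms(2))
  also have "\<dots> = (\<Oplus>\<^bsub>A\<^esub>i \<in> {..n}. p i \<otimes>\<^bsub>A\<^esub> t [^]\<^bsub>A\<^esub> i)"
    by (rule A.add.finprod_mono_neutral_cong_left)
      (use d 0 assms(2,3) in \<open>auto simp: mem_upD\<close>)
  finally show ?thesis .
qed

lemma poly_eval_map:
  assumes A: "algebra K A" and B: "algebra K B" and \<phi>: "\<phi> \<in> algebra_hom K A B"
    and t: "t \<in> carrier A" and p: "p \<in> carrier (poly_algebra A)"
  shows "poly_eval B (\<phi> t) (poly_map \<phi> p) = \<phi> (poly_eval A t p)"
proof -
  interpret A: algebra K A by fact
  interpret B: algebra K B by fact
  interpret \<phi>: ring_hom_cring A B \<phi>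
    by (rule ring_hom_cringI[OF A.M_cring B.M_cring algebra_hom_ring_hom[OF \<phi>]])
  obtain q where q: "p = Seq q" "q \<in> up A" using p by (auto simp: poly_algebra_simps)
  then obtain n where n: "\<And>m. n < m \<Longrightarrow> q m = \<zero>\<^bsub>A\<^esub>" by (auto simp: up_def bound_def)
  have "poly_eval B (\<phi> t) (poly_map \<phi> p) = (\<Oplus>\<^bsub>B\<^esub>i \<in> {..n}. \<phi> (q i) \<otimes>\<^bsub>B\<^esub> \<phi> t [^]\<^bsub>B\<^esub> i)"
    unfolding q poly_map_def test.sel
    by (rule poly_eval_sum[OF B]) (use t n up_hom[OF A B \<phi> q(2)] in simp_all)
  also have "\<dots> = \<phi> (\<Oplus>\<^bsub>A\<^esub>i \<in> {..n}. q i \<otimes>\<^bsub>A\<^esub> t [^]\<^bsub>A\<^esub> i)"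
    using t q(2) by (simp add: mem_upD Pi_def o_def)
  also have "\<dots> = \<phi> (poly_eval A t p)"
    using poly_eval_sum[OF A q(2) t n] q by simp
  finally show ?thesis .
qed

section \<open>Modules of points\<close>

lemma vec_module_module:
  assumes "module K V"
  shows "module K (vec_module V)"
proof -
  interpret V: module K V by fact
  have neg: "\<exists>y\<in>carrier V. y \<oplus>\<^bsub>V\<^esub> x = \<zero>\<^bsub>V\<^esub>" if "x \<in> carrier V" for x
    using that V.l_neg by blast
  show ?thesis
    by (rule moduleI, rule V.is_cring, rule abelian_groupI)
      (auto simp: vec_module_def V.a_ac V.smult_l_distr V.smult_r_distr V.smult_assoc1 neg)
qed

lemma scal_module_module:
  assumes "cring K"
  shows "module K (scal_module K)"
proof -
  interpret K: cring K by fact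
  have neg: "\<exists>y\<in>carrier K. y \<oplus>\<^bsub>K\<^esub> x = \<zero>\<^bsub>K\<^esub>" if "x \<in> carrier K" for x
    using that K.l_neg by blast
  show ?thesis
    by (rule moduleI, rule K.is_cring, rule abelian_groupI)
      (auto simp: scal_module_def K.a_ac K.m_ac K.l_distr K.r_distr neg)
qed

lemma prod_module_module:
  assumes "module K E" "module K F"
  shows "module K (prod_module E F)"
proof -
  interpret E: module K E by fact
  interpret F: module K F by fact
  show ?thesis
  proof (rule moduleI, rule E.is_cring, rule abelian_groupI)
    fix p
    assume "p \<in> carrier (prod_module E F)"
    then obtain x y where "p = \<langle>x, y\<rangle>" "x \<in> carrier E" "y \<in> carrier F" by (auto simp: prod_module_def)
    then show "\<exists>q\<in>carrier (prod_module E F). q \<oplus>\<^bsub>prod_module E F\<^esub> p = \<zero>\<^bsub>prod_module E F\<^esub>"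
      by (intro bexI[of _ "\<langle>\<ominus>\<^bsub>E\<^esub> x, \<ominus>\<^bsub>F\<^esub> y\<rangle>"]) (auto simp: prod_module_def E.l_neg F.l_neg)
  qed (auto simp: prod_module_def E.a_ac F.a_ac E.smult_l_distr F.smult_l_distr E.smult_r_distr
      F.smult_r_distr E.smult_assoc1 F.smult_assoc1)
qed

lemma module_cring: "module K M \<Longrightarrow> cring K"
  by (simp add: module_def)

lemma obj_module_module: "module K E \<Longrightarrow> module K (obj_module K E)"
  by (simp add: obj_module_def prod_module_module scal_module_module module_cring)

lemma mor_module_module: "module K E \<Longrightarrow> module K (mor_module K E)"
  by (simp add: mor_module_def prod_module_module scal_module_module module_cring)

lemma pfst_module_hom: "pfst \<in> module_hom K (prod_module E F) E"
  by (rule module_homI) (auto simp: prod_module_def)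

lemma psnd_module_hom: "psnd \<in> module_hom K (prod_module E F) F"
  by (rule module_homI) (auto simp: prod_module_def)

lemma pair_left_module_hom:
  assumes "module K F"
  shows "(\<lambda>x. \<langle>x, \<zero>\<^bsub>F\<^esub>\<rangle>) \<in> module_hom K E (prod_module E F)"
proof -
  interpret F: module K F by fact
  show ?thesis by (rule module_homI) (auto simp: prod_module_def)
qed

lemma pair_right_module_hom:
  assumes "module K E"
  shows "(\<lambda>y. \<langle>\<zero>\<^bsub>E\<^esub>, y\<rangle>) \<in> module_hom K F (prod_module E F)"
proof -
  interpret E: module K E by fact
  show ?thesis by (rule module_homI) (auto simp: prod_module_def)
qed

lemma mor_x_module_hom: "pfst \<in> module_hom K (mor_module K E) E"
  unfolding mor_module_def by (rule pfst_module_hom)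

lemma mor_v_module_hom: "(\<lambda>p. pfst (psnd p)) \<in> module_hom K (mor_module K E) E"
  unfolding mor_module_def using module_hom_compose[OF psnd_module_hom pfst_module_hom] by (simp add: o_def)

lemma mor_k_module_hom: "(\<lambda>p. psnd (psnd p)) \<in> module_hom K (mor_module K E) (scal_module K)"
  unfolding mor_module_def using module_hom_compose[OF psnd_module_hom psnd_module_hom] by (simp add: o_def)

lemma obj_module_carrier:
  "\<langle>x, Scal t\<rangle> \<in> carrier (obj_module K E) \<longleftrightarrow> x \<in> carrier E \<and> t \<in> carrier K"
  by (auto simp: obj_module_def prod_module_def scal_module_def)

lemma mor_module_carrier:
  "\<langle>x, \<langle>v, Scal t\<rangle>\<rangle> \<in> carrier (mor_module K E) \<longleftrightarrow> x \<in> carrier E \<and> v \<in> carrier E \<and> t \<in> carrier K"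
  by (auto simp: mor_module_def prod_module_def scal_module_def)

section \<open>Polynomial laws\<close>

lemma polynomial_law_closed:
  "polynomial_law K M N P \<Longrightarrow> algebra K A \<Longrightarrow> z \<in> carrier (tensor_product K M A) \<Longrightarrow>
    P A z \<in> carrier (tensor_product K N A)"
  by (auto simp: polynomial_law_def)

lemma polynomial_law_natural:
  "polynomial_law K M N P \<Longrightarrow> algebra K A \<Longrightarrow> algebra K B \<Longrightarrow> \<phi> \<in> algebra_hom K A B \<Longrightarrow>
    z \<in> carrier (tensor_product K M A) \<Longrightarrow>
    P B (tensor_map K M B id \<phi> z) = tensor_map K N B id \<phi> (P A z)"
  by (auto simp: polynomial_law_def)

lemma polynomial_lawI:
  assumes "\<And>A z. algebra K A \<Longrightarrow> z \<in> carrier (tensor_product K M A) \<Longrightarrow>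
      P A z \<in> carrier (tensor_product K N A)"
    and "\<And>A B \<phi> z. algebra K A \<Longrightarrow> algebra K B \<Longrightarrow> \<phi> \<in> algebra_hom K A B \<Longrightarrow>
      z \<in> carrier (tensor_product K M A) \<Longrightarrow>
      P B (tensor_map K M B id \<phi> z) = tensor_map K N B id \<phi> (P A z)"
  shows "polynomial_law K M N P"
  using assms by (auto simp: polynomial_law_def)

text \<open>f acts on the first factor and \<phi> on the second, so both orders of application give
  f \<otimes> \<phi>.\<close>

lemma linear_law_law:
  assumes M: "module K M" and N: "module K N" and f: "f \<in> module_hom K M N"
  shows "polynomial_law K M N (linear_law K N f)"
proof (rule polynomial_lawI)
  fix A :: "('a, 'd) test_algebra" and z
  assume A: "algebra K A" and z: "z \<in> carrier (tensor_product K M A)"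
  note A = algebra_is_module[OF A]
  show "linear_law K N f A z \<in> carrier (tensor_product K N A)"
    unfolding linear_law_def by (rule tensor_map_closed[OF M A N A f module_hom_id z])
next
  fix A B :: "('a, 'd) test_algebra" and \<phi> z
  assume "algebra K A" "algebra K B" and h: "\<phi> \<in> algebra_hom K A B"
    and z: "z \<in> carrier (tensor_product K M A)"
  then have A: "module K A" and B: "module K B" by (simp_all add: algebra_is_module)
  note h = algebra_hom_module_hom[OF h]
  show "linear_law K N f B (tensor_map K M B id \<phi> z) = tensor_map K N B id \<phi> (linear_law K N f A z)"
    unfolding linear_law_def
    by (simp add: tensor_map_compose[OF M A M B N B module_hom_id h f module_hom_id z]
        tensor_map_compose[OF M A N A N B f module_hom_id module_hom_id h z])
qed

lemma law_comp_law:
  "polynomial_law K M N P \<Longrightarrow> polynomial_law K N L Q \<Longrightarrow> polynomial_law K M L (law_comp Q P)"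
  by (rule polynomial_lawI) (simp_all add: law_comp_def polynomial_law_closed polynomial_law_natural)

text \<open>Base change along \<phi> is additive, so laws can be added pointwise. Pairs of laws and
  the translation x + tv are such sums.\<close>

lemma law_sum_law:
  assumes N: "module K N" and P: "polynomial_law K M N P" and Q: "polynomial_law K M N Q"
  shows "polynomial_law K M N (\<lambda>A z. P A z \<oplus>\<^bsub>tensor_product K N A\<^esub> Q A z)"
proof (rule polynomial_lawI)
  fix A :: "('a, 'd) test_algebra" and z
  assume A: "algebra K A" and z: "z \<in> carrier (tensor_product K M A)"
  interpret T: abelian_group "tensor_product K N A"
    by (rule tensor_abelian_group[OF N algebra_is_module[OF A]])
  show "P A z \<oplus>\<^bsub>tensor_product K N A\<^esub> Q A z \<in> carrier (tensor_product K N A)"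
    by (simp add: polynomial_law_closed[OF P A z] polynomial_law_closed[OF Q A z])
next
  fix A B :: "('a, 'd) test_algebra" and \<phi> z
  assume A: "algebra K A" and B: "algebra K B" and h: "\<phi> \<in> algebra_hom K A B"
    and z: "z \<in> carrier (tensor_product K M A)"
  note m = algebra_is_module
  show "P B (tensor_map K M B id \<phi> z) \<oplus>\<^bsub>tensor_product K N B\<^esub> Q B (tensor_map K M B id \<phi> z)
      = tensor_map K N B id \<phi> (P A z \<oplus>\<^bsub>tensor_product K N A\<^esub> Q A z)"
    by (simp add: polynomial_law_natural[OF P A B h z] polynomial_law_natural[OF Q A B h z]
        tensor_map_add[OF N m[OF A] N m[OF B] module_hom_id algebra_hom_module_hom[OF h]]
        polynomial_law_closed[OF P A z] polynomial_law_closed[OF Q A z])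
qed

text \<open>A pair is the sum of its two parts, each followed by a linear embedding into the
  product.\<close>

lemma law_pair_law:
  assumes E: "module K E" and F: "module K F"
    and P: "polynomial_law K M E P" and Q: "polynomial_law K M F Q"
  shows "polynomial_law K M (prod_module E F) (law_pair K E F P Q)"
  using law_sum_law[OF prod_module_module[OF E F]
      law_comp_law[OF P linear_law_law[OF E prod_module_module[OF E F] pair_left_module_hom[OF F]]]
      law_comp_law[OF Q linear_law_law[OF F prod_module_module[OF E F] pair_right_module_hom[OF E]]]]
  by (simp add: law_pair_def law_comp_def)

text \<open>Carries a factorisation of K-linear maps, known only on the carrier of the algebra, to
  tensors. Substitutions, shifts and constants are combined through this rule.\<close>

lemma tensor_map_compose_right:
  assumes M: "module K M" and A: "module K A" and B: "module K B" and C: "module K C"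
    and g: "g \<in> module_hom K A B" and g': "g' \<in> module_hom K B C" and h: "h \<in> module_hom K A C"
    and eq: "\<And>a. a \<in> carrier A \<Longrightarrow> g' (g a) = h a"
    and z: "z \<in> carrier (tensor_product K M A)"
  shows "tensor_map K M C id g' (tensor_map K M B id g z) = tensor_map K M C id h z"
proof -
  have "tensor_map K M C id (g' \<circ> g) z = tensor_map K M C id h z"
    by (rule tensor_map_cong[OF M A M C module_hom_id module_hom_compose[OF g g'] module_hom_id h _ _ z])
      (simp_all add: eq)
  then show ?thesis
    by (simp add: tensor_map_compose[OF M A M B M C module_hom_id g module_hom_id g' z])
qed

lemma tensor_scale_closed:
  assumes "module K M" "algebra K A" "a \<in> carrier A" "z \<in> carrier (tensor_product K M A)"
  shows "tensor_scale K M A a z \<in> carrier (tensor_product K M A)"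
  unfolding tensor_scale_def
  by (rule tensor_map_closed[OF assms(1) algebra_is_module assms(1) algebra_is_module module_hom_id
        mult_module_hom[OF assms(2,3)] assms(4)]) (rule assms(2))+

text \<open>Both sides are induced by the single map b |-> \<phi>(ab) = \<phi>(a)\<phi>(b) on the
  algebra.\<close>

lemma tensor_scale_natural:
  assumes M: "module K M" and A: "algebra K A" and B: "algebra K B" and h: "\<phi> \<in> algebra_hom K A B"
    and a: "a \<in> carrier A" and z: "z \<in> carrier (tensor_product K M A)"
  shows "tensor_map K M B id \<phi> (tensor_scale K M A a z)
    = tensor_scale K M B (\<phi> a) (tensor_map K M B id \<phi> z)"
proof -
  note m = algebra_is_module[OF A] algebra_is_module[OF B]
  note hm = algebra_hom_module_hom[OF h]
  have b: "\<phi> a \<in> carrier B" by (rule module_hom_closed[OF hm a])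
  have c: "(\<lambda>x. \<phi> (a \<otimes>\<^bsub>A\<^esub> x)) \<in> module_hom K A B"
    using module_hom_compose[OF mult_module_hom[OF A a] hm] by (simp add: o_def)
  have "tensor_map K M B id \<phi> (tensor_scale K M A a z) = tensor_map K M B id (\<lambda>x. \<phi> (a \<otimes>\<^bsub>A\<^esub> x)) z"
    unfolding tensor_scale_def
    by (rule tensor_map_compose_right[OF M m(1) m(1) m(2) mult_module_hom[OF A a] hm c _ z]) simp
  also have "\<dots> = tensor_scale K M B (\<phi> a) (tensor_map K M B id \<phi> z)"
    unfolding tensor_scale_def
    by (rule tensor_map_compose_right[OF M m(1) m(2) m(2) hm mult_module_hom[OF B b] c _ z, symmetric])
      (simp add: algebra_hom_mult[OF h a])
  finally show ?thesis .
qed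

section \<open>The components of a morphism over a test algebra\<close>

lemma mor_x_law: "module K E \<Longrightarrow> polynomial_law K (mor_module K E) E (mor_x K E)"
  unfolding mor_x_def by (rule linear_law_law[OF mor_module_module _ mor_x_module_hom])

lemma mor_v_law: "module K E \<Longrightarrow> polynomial_law K (mor_module K E) E (mor_v K E)"
  unfolding mor_v_def by (rule linear_law_law[OF mor_module_module _ mor_v_module_hom])

lemma mor_k_law: "module K E \<Longrightarrow> polynomial_law K (mor_module K E) (scal_module K) (mor_k K)"
  unfolding mor_k_def
  by (rule linear_law_law[OF mor_module_module _ mor_k_module_hom])
    (simp_all add: scal_module_module module_cring)

text \<open>On the third component this is the pairing behind K \<otimes> A \<cong> A. Moving k
  across means (kt)a = t(ka), where commutativity of K enters.\<close>

lemma mor_t_balanced: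
  assumes E: "module K E" and A: "algebra K A"
  shows "balanced K (mor_module K E) A A (\<lambda>p a. scal (psnd (psnd p)) \<odot>\<^bsub>A\<^esub> a)"
proof -
  interpret A: algebra K A by fact
  show ?thesis
    unfolding balanced_def mor_module_def prod_module_def scal_module_def
    by (auto simp: A.smult_l_distr A.smult_r_distr A.smult_assoc1 simp flip: A.smult_assoc1)
      (simp add: A.R.m_comm)
qed

lemma mor_t_hom:
  assumes "module K E" "algebra K A"
  shows "mor_t A \<in> add_hom (tensor_product K (mor_module K E) A) A"
  unfolding mor_t_def
  by (rule tensor_lift_hom[OF mor_module_module[OF assms(1)] algebra_is_module[OF assms(2)]
        module_abelian_group[OF algebra_is_module[OF assms(2)]] mor_t_balanced[OF assms]])

lemma mor_t_pure:
  assumes "module K E" "algebra K A" "p \<in> carrier (mor_module K E)" "a \<in> carrier A"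
  shows "mor_t A (pure_tensor K (mor_module K E) A p a) = scal (psnd (psnd p)) \<odot>\<^bsub>A\<^esub> a"
  unfolding mor_t_def
  by (rule tensor_lift_pure[OF mor_module_module[OF assms(1)] algebra_is_module[OF assms(2)]
        module_abelian_group[OF algebra_is_module[OF assms(2)]] mor_t_balanced[OF assms(1,2)] assms(3,4)])

text \<open>\<open>mor_t\<close> takes values in A and not in a tensor product, so functoriality
  does not apply. On pure tensors the claim is the K-linearity of \<phi>.\<close>

lemma mor_t_natural:
  assumes E: "module K E" and A: "algebra K A" and B: "algebra K B" and h: "\<phi> \<in> algebra_hom K A B"
    and z: "z \<in> carrier (tensor_product K (mor_module K E) A)"
  shows "mor_t B (tensor_map K (mor_module K E) B id \<phi> z) = \<phi> (mor_t A z)"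
proof -
  note M = mor_module_module[OF E]
  note m = algebra_is_module[OF A] algebra_is_module[OF B]
  note hm = algebra_hom_module_hom[OF h]
  show ?thesis
  proof (rule tensor_hom_ext[OF M m(1) module_abelian_group[OF m(2)]
        add_hom_compose[OF tensor_map_hom[OF M m(1) M m(2) module_hom_id hm] mor_t_hom[OF E B]]
        add_hom_compose[OF mor_t_hom[OF E A] module_hom_add_hom[OF hm]] _ z])
    fix p a
    assume p: "p \<in> carrier (mor_module K E)" and a: "a \<in> carrier A"
    have "scal (psnd (psnd p)) \<in> carrier K"
      using p by (auto simp: mor_module_def prod_module_def scal_module_def)
    then show "mor_t B (tensor_map K (mor_module K E) B id \<phi> (pure_tensor K (mor_module K E) A p a))
        = \<phi> (mor_t A (pure_tensor K (mor_module K E) A p a))"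
      using p a
      by (simp add: tensor_map_pure[OF M m(1) M m(2) module_hom_id hm] mor_t_pure[OF E A]
          mor_t_pure[OF E B] module_hom_closed[OF hm] module_hom_smult[OF hm])
  qed
qed

text \<open>The scalar t is itself a component of z, so the second summand is not a linear law. Its
  naturality combines that of t, of v and of scaling.\<close>

lemma translation_law:
  assumes E: "module K E"
  shows "polynomial_law K (mor_module K E) E
    (\<lambda>A z. mor_x K E A z \<oplus>\<^bsub>tensor_product K E A\<^esub> tensor_scale K E A (mor_t A z) (mor_v K E A z))"
proof (rule law_sum_law[OF E mor_x_law[OF E]], rule polynomial_lawI)
  fix A :: "('a, 'd) test_algebra" and z
  assume A: "algebra K A" and z: "z \<in> carrier (tensor_product K (mor_module K E) A)"
  show "tensor_scale K E A (mor_t A z) (mor_v K E A z) \<in> carrier (tensor_product K E A)"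
    by (rule tensor_scale_closed[OF E A add_hom_closed[OF mor_t_hom[OF E A] z]
          polynomial_law_closed[OF mor_v_law[OF E] A z]])
next
  fix A B :: "('a, 'd) test_algebra" and \<phi> z
  assume A: "algebra K A" and B: "algebra K B" and h: "\<phi> \<in> algebra_hom K A B"
    and z: "z \<in> carrier (tensor_product K (mor_module K E) A)"
  let ?z = "tensor_map K (mor_module K E) B id \<phi> z"
  show "tensor_scale K E B (mor_t B ?z) (mor_v K E B ?z)
      = tensor_map K E B id \<phi> (tensor_scale K E A (mor_t A z) (mor_v K E A z))"
    by (simp add: mor_t_natural[OF E A B h z] polynomial_law_natural[OF mor_v_law[OF E] A B h z]
        tensor_scale_natural[OF E A B h add_hom_closed[OF mor_t_hom[OF E A] z]
          polynomial_law_closed[OF mor_v_law[OF E] A z]])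
qed

lemma new_edge_tgt_law:
  assumes E: "module K E"
  shows "polynomial_law K (mor_module K E) (obj_module K E) (tgt (new_edge K E))"
  unfolding new_edge_def obj_module_def groupoid_laws.simps
  by (rule law_pair_law[OF E scal_module_module translation_law[OF E] mor_k_law[OF E]])
    (rule module_cring[OF E])

lemma obj_law_law:
  assumes E: "module K E" and F: "module K F" and P: "polynomial_law K E F P"
  shows "polynomial_law K (obj_module K E) (obj_module K F) (obj_law K E F P)"
proof -
  have S: "module K (scal_module K)" by (rule scal_module_module[OF module_cring[OF E]])
  show ?thesis
    unfolding obj_law_def obj_module_def
    by (intro law_pair_law[OF F S] law_comp_law[OF linear_law_law P] linear_law_law
        prod_module_module pfst_module_hom psnd_module_hom E S)
qed

section \<open>Difference quotients of polynomial laws\<close>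

text \<open>The argument of \<open>P\<close> over A[T] in \<open>slope_law\<close>, named so that
  substitutions for T can be computed in it apart from any law.\<close>

definition slope_point ::
  "'k ring \<Rightarrow> ('k, 'v) pmodule \<Rightarrow> ('k, 'x) test_algebra
   \<Rightarrow> (('k, 'v) point, ('k, 'x) test) tensor \<Rightarrow> (('k, 'v) point, ('k, 'x) test) tensor" where
  "slope_point K E A z =
     tensor_map K E (poly_algebra A) id (poly_const A) (mor_x K E A z)
       \<oplus>\<^bsub>tensor_product K E (poly_algebra A)\<^esub>
     tensor_scale K E (poly_algebra A) (poly_var A)
       (tensor_map K E (poly_algebra A) id (poly_const A) (mor_v K E A z))"

lemma tensor_const_closed:
  assumes "module K F" "algebra K A" "y \<in> carrier (tensor_product K F A)"
  shows "tensor_map K F (poly_algebra A) id (poly_const A) y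
    \<in> carrier (tensor_product K F (poly_algebra A))"
  by (rule tensor_map_closed[OF assms(1) algebra_is_module[OF assms(2)] assms(1)
        algebra_is_module[OF poly_algebra_algebra[OF assms(2)]] module_hom_id
        algebra_hom_module_hom[OF poly_const_hom[OF assms(2)]] assms(3)])

lemma slope_point_closed:
  assumes E: "module K E" and A: "algebra K A"
    and z: "z \<in> carrier (tensor_product K (mor_module K E) A)"
  shows "slope_point K E A z \<in> carrier (tensor_product K E (poly_algebra A))"
proof -
  note B = poly_algebra_algebra[OF A]
  interpret T: abelian_group "tensor_product K E (poly_algebra A)"
    by (rule tensor_abelian_group[OF E algebra_is_module[OF B]])
  show ?thesis
    unfolding slope_point_def
    by (intro T.a_closed tensor_scale_closed[OF E B poly_var_closed[OF A]] tensor_const_closed[OF E A]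
        polynomial_law_closed[OF mor_x_law[OF E] A z] polynomial_law_closed[OF mor_v_law[OF E] A z])
qed

text \<open>One computation serves all substitutions. With g = \<open>id\<close> it covers T = 0 and
  T = t; with \<psi> = \<open>poly_map \<phi>\<close> and g sending a to the constant \<phi>(a) it
  covers a change of algebra.\<close>

lemma slope_point_hom:
  assumes E: "module K E" and A: "algebra K A" and C: "algebra K C"
    and h: "\<psi> \<in> algebra_hom K (poly_algebra A) C" and g: "g \<in> module_hom K A C"
    and eq: "\<And>a. a \<in> carrier A \<Longrightarrow> \<psi> (poly_const A a) = g a"
    and z: "z \<in> carrier (tensor_product K (mor_module K E) A)"
  shows "tensor_map K E C id \<psi> (slope_point K E A z)
    = tensor_map K E C id g (mor_x K E A z) \<oplus>\<^bsub>tensor_product K E C\<^esub>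
      tensor_scale K E C (\<psi> (poly_var A)) (tensor_map K E C id g (mor_v K E A z))"
proof -
  note B = poly_algebra_algebra[OF A]
  note m = algebra_is_module[OF A] algebra_is_module[OF B] algebra_is_module[OF C]
  note x = polynomial_law_closed[OF mor_x_law[OF E] A z]
  note v = polynomial_law_closed[OF mor_v_law[OF E] A z]
  note comp = tensor_map_compose_right[OF E m algebra_hom_module_hom[OF poly_const_hom[OF A]]
      algebra_hom_module_hom[OF h] g eq]
  show ?thesis
    unfolding slope_point_def
    by (simp add: tensor_map_add[OF E m(2) E m(3) module_hom_id algebra_hom_module_hom[OF h]]
        tensor_scale_natural[OF E B C h poly_var_closed[OF A]] comp x v tensor_const_closed[OF E A]
        tensor_scale_closed[OF E B poly_var_closed[OF A]])
qed

lemma slope_point_natural: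
  assumes E: "module K E" and A: "algebra K A" and C: "algebra K C" and h: "\<phi> \<in> algebra_hom K A C"
    and z: "z \<in> carrier (tensor_product K (mor_module K E) A)"
  shows "slope_point K E C (tensor_map K (mor_module K E) C id \<phi> z)
    = tensor_map K E (poly_algebra C) id (poly_map \<phi>) (slope_point K E A z)"
proof -
  note D = poly_algebra_algebra[OF C]
  note m = algebra_is_module[OF A] algebra_is_module[OF C] algebra_is_module[OF D]
  note hm = algebra_hom_module_hom[OF h]
  note pc = algebra_hom_module_hom[OF poly_const_hom[OF C]]
  have g: "(\<lambda>a. poly_const C (\<phi> a)) \<in> module_hom K A (poly_algebra C)"
    using module_hom_compose[OF hm pc] by (simp add: o_def)
  note comp = tensor_map_compose_right[OF E m hm pc g refl]
  show ?thesis
    by (subst slope_point_hom[OF E A D poly_map_hom[OF A C h] g poly_map_const[OF A C h] z])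
      (simp_all add: slope_point_def polynomial_law_natural[OF mor_x_law[OF E] A C h z]
        polynomial_law_natural[OF mor_v_law[OF E] A C h z] comp
        polynomial_law_closed[OF mor_x_law[OF E] A z] polynomial_law_closed[OF mor_v_law[OF E] A z]
        poly_map_var[OF A C h])
qed

lemma tensor_shift_const:
  assumes F: "module K F" and A: "algebra K A" and y: "y \<in> carrier (tensor_product K F A)"
  shows "tensor_map K F (poly_algebra A) id poly_shift
      (tensor_map K F (poly_algebra A) id (poly_const A) y)
    = \<zero>\<^bsub>tensor_product K F (poly_algebra A)\<^esub>"
proof -
  note m = algebra_is_module[OF A] algebra_is_module[OF poly_algebra_algebra[OF A]]
  interpret B: module K "poly_algebra A" by (rule m(2))
  have z: "(\<lambda>_. \<zero>\<^bsub>poly_algebra A\<^esub>) \<in> module_hom K A (poly_algebra A)"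
    by (rule module_homI) auto
  have "tensor_map K F (poly_algebra A) id poly_shift
      (tensor_map K F (poly_algebra A) id (poly_const A) y)
    = tensor_map K F (poly_algebra A) id (\<lambda>_. \<zero>\<^bsub>poly_algebra A\<^esub>) y"
    by (rule tensor_map_compose_right[OF F m(1) m(2) m(2) algebra_hom_module_hom[OF poly_const_hom[OF A]]
          poly_shift_hom z poly_shift_const y])
  also have "\<dots> = \<zero>\<^bsub>tensor_product K F (poly_algebra A)\<^esub>"
    by (rule tensor_map_zero[OF F m(1) F m(2) module_hom_id y])
  finally show ?thesis .
qed

lemma tensor_shift_var:
  assumes F: "module K F" and A: "algebra K A"
    and w: "w \<in> carrier (tensor_product K F (poly_algebra A))"
  shows "tensor_map K F (poly_algebra A) id poly_shift
      (tensor_scale K F (poly_algebra A) (poly_var A) w) = w"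
proof -
  note m = algebra_is_module[OF poly_algebra_algebra[OF A]]
  have "tensor_map K F (poly_algebra A) id poly_shift
      (tensor_scale K F (poly_algebra A) (poly_var A) w) = tensor_map K F (poly_algebra A) id id w"
    unfolding tensor_scale_def
    by (rule tensor_map_compose_right[OF F m m m mult_module_hom[OF poly_algebra_algebra[OF A]
            poly_var_closed[OF A]] poly_shift_hom module_hom_id _ w])
      (simp add: poly_shift_var_mult[OF A])
  then show ?thesis by (simp add: tensor_map_id[OF F m w])
qed

lemma tensor_poly_decomp:
  assumes F: "module K F" and A: "algebra K A"
    and u: "u \<in> carrier (tensor_product K F (poly_algebra A))"
  shows "u = tensor_map K F (poly_algebra A) id (poly_const A) (tensor_map K F A id (\<lambda>p. coeffs p 0) u)
      \<oplus>\<^bsub>tensor_product K F (poly_algebra A)\<^esub>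
    tensor_scale K F (poly_algebra A) (poly_var A) (tensor_map K F (poly_algebra A) id poly_shift u)"
proof -
  note B = poly_algebra_algebra[OF A]
  note m = algebra_is_module[OF A] algebra_is_module[OF B]
  note c = algebra_hom_module_hom[OF poly_const_hom[OF A]]
  note e = algebra_hom_module_hom[OF coeffs_zero_hom[OF A]]
  note v = mult_module_hom[OF B poly_var_closed[OF A]]
  have ce: "(\<lambda>p. poly_const A (coeffs p 0)) \<in> module_hom K (poly_algebra A) (poly_algebra A)"
    using module_hom_compose[OF e c] by (simp add: o_def)
  have vs: "(\<lambda>p. poly_var A \<otimes>\<^bsub>poly_algebra A\<^esub> poly_shift p)
      \<in> module_hom K (poly_algebra A) (poly_algebra A)"
    using module_hom_compose[OF poly_shift_hom v] by (simp add: o_def)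
  \<comment> \<open>The identity of A[T] is inserted in order to be split into two K-linear maps,
    constant term and T times shift. Each of them is then factored by functoriality.\<close>
  have "u = tensor_map K F (poly_algebra A) id id u"
    by (simp add: tensor_map_id[OF F m(2) u])
  also have "\<dots> = tensor_map K F (poly_algebra A) id (\<lambda>p. poly_const A (coeffs p 0)) u
      \<oplus>\<^bsub>tensor_product K F (poly_algebra A)\<^esub>
    tensor_map K F (poly_algebra A) id (\<lambda>p. poly_var A \<otimes>\<^bsub>poly_algebra A\<^esub> poly_shift p) u"
    by (rule tensor_map_sum_right[OF F m(2) F m(2) module_hom_id ce vs module_hom_id _ u])
      (simp add: poly_decomp[OF A, symmetric])
  also have "tensor_map K F (poly_algebra A) id (\<lambda>p. poly_const A (coeffs p 0)) u
      = tensor_map K F (poly_algebra A) id (poly_const A) (tensor_map K F A id (\<lambda>p. coeffs p 0) u)"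
    by (rule tensor_map_compose_right[OF F m(2) m(1) m(2) e c ce refl u, symmetric])
  also have "tensor_map K F (poly_algebra A) id (\<lambda>p. poly_var A \<otimes>\<^bsub>poly_algebra A\<^esub> poly_shift p) u
      = tensor_scale K F (poly_algebra A) (poly_var A) (tensor_map K F (poly_algebra A) id poly_shift u)"
    unfolding tensor_scale_def
    by (rule tensor_map_compose_right[OF F m(2) m(2) m(2) poly_shift_hom v vs refl u, symmetric])
  finally show ?thesis .
qed

text \<open>Disposes of the term Tv after the substitution T = 0.\<close>

lemma tensor_scale_zero:
  assumes M: "module K M" and A: "algebra K A" and z: "z \<in> carrier (tensor_product K M A)"
  shows "tensor_scale K M A \<zero>\<^bsub>A\<^esub> z = \<zero>\<^bsub>tensor_product K M A\<^esub>"
proof -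
  interpret A: algebra K A by fact
  note m = algebra_is_module[OF A]
  have 0: "(\<lambda>_. \<zero>\<^bsub>A\<^esub>) \<in> module_hom K A A"
    by (rule module_homI) auto
  have "tensor_scale K M A \<zero>\<^bsub>A\<^esub> z = tensor_map K M A id (\<lambda>_. \<zero>\<^bsub>A\<^esub>) z"
    unfolding tensor_scale_def
    by (rule tensor_map_cong[OF M m M m module_hom_id mult_module_hom[OF A A.zero_closed]
          module_hom_id 0 _ _ z]) simp_all
  then show ?thesis by (simp add: tensor_map_zero[OF M m M m module_hom_id z])
qed

section \<open>Existence, uniqueness and naturality of the difference quotient\<close>

context
  fixes K :: "'k ring" and E F :: "('k, 'v) pmodule" and P :: "('k, 'v, 'x) plaw"
  assumes E: "module K E" and F: "module K F" and P: "polynomial_law K E F P"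
begin

context
  fixes A :: "('k, 'x) test_algebra" and z :: "(('k, 'v) point, ('k, 'x) test) tensor"
  assumes A: "algebra K A" and z: "z \<in> carrier (tensor_product K (mor_module K E) A)"
begin

abbreviation (input) "at_slope_point \<equiv> P (poly_algebra A) (slope_point K E A z)"

lemma at_slope_point_closed: "at_slope_point \<in> carrier (tensor_product K F (poly_algebra A))"
  by (rule polynomial_law_closed[OF P poly_algebra_algebra[OF A] slope_point_closed[OF E A z]])

text \<open>Existence of the quotient. After the general decomposition only the constant term has to
  be identified: the substitution T = 0 is an algebra homomorphism, so it moves inside
  \<open>P\<close>, where it turns x + Tv into x.\<close>

lemma at_slope_point_decomp:
  "at_slope_point = tensor_map K F (poly_algebra A) id (poly_const A) (P A (mor_x K E A z))
      \<oplus>\<^bsub>tensor_product K F (poly_algebra A)\<^esub>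
    tensor_scale K F (poly_algebra A) (poly_var A)
      (tensor_map K F (poly_algebra A) id poly_shift at_slope_point)"
proof -
  interpret A: algebra K A by (rule A)
  interpret T: abelian_group "tensor_product K E A"
    by (rule tensor_abelian_group[OF E algebra_is_module[OF A]])
  note x = polynomial_law_closed[OF mor_x_law[OF E] A z]
  note v = polynomial_law_closed[OF mor_v_law[OF E] A z]
  have var: "coeffs (poly_var A) 0 = \<zero>\<^bsub>A\<^esub>" by (simp add: poly_var_def UP_simps)
  have "tensor_map K F A id (\<lambda>p. coeffs p 0) at_slope_point
      = P A (tensor_map K E A id (\<lambda>p. coeffs p 0) (slope_point K E A z))"
    by (rule polynomial_law_natural[OF P poly_algebra_algebra[OF A] A coeffs_zero_hom[OF A]
          slope_point_closed[OF E A z], symmetric])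
  also have "tensor_map K E A id (\<lambda>p. coeffs p 0) (slope_point K E A z) = mor_x K E A z"
    by (subst slope_point_hom[OF E A A coeffs_zero_hom[OF A] module_hom_id _ z])
      (simp_all add: poly_const_Seq var tensor_map_id[OF E algebra_is_module[OF A]] x v
        tensor_scale_zero[OF E A])
  finally have "tensor_map K F A id (\<lambda>p. coeffs p 0) at_slope_point = P A (mor_x K E A z)" .
  with tensor_poly_decomp[OF F A at_slope_point_closed] show ?thesis by (simp only:)
qed

text \<open>Trades the description by \<open>THE\<close> for two linear maps applied to
  \<open>P (x + Tv)\<close>. Closure, the increment formula and naturality are read off from this
  form.\<close>

lemma slope_law_eq:
  "slope_law K E F P A z = tensor_map K F A id (poly_eval A (mor_t A z))
     (tensor_map K F (poly_algebra A) id poly_shift at_slope_point)"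
proof -
  let ?B = "poly_algebra A"
  let ?W = "tensor_product K F ?B"
  let ?c = "tensor_map K F ?B id (poly_const A) (P A (mor_x K E A z))"
  let ?s = "tensor_map K F ?B id poly_shift"
  note B = poly_algebra_algebra[OF A]
  note m = algebra_is_module[OF B]
  interpret W: abelian_group ?W by (rule tensor_abelian_group[OF F m])
  note x = polynomial_law_closed[OF P A polynomial_law_closed[OF mor_x_law[OF E] A z]]
  have "(THE w. w \<in> carrier ?W \<and> at_slope_point = ?c \<oplus>\<^bsub>?W\<^esub> tensor_scale K F ?B (poly_var A) w)
      = ?s at_slope_point"
  proof (rule the_equality)
    show "?s at_slope_point \<in> carrier ?W \<and>
        at_slope_point = ?c \<oplus>\<^bsub>?W\<^esub> tensor_scale K F ?B (poly_var A) (?s at_slope_point)"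
      using at_slope_point_decomp
        tensor_map_closed[OF F m F m module_hom_id poly_shift_hom at_slope_point_closed] by simp
    fix w
    assume w: "w \<in> carrier ?W \<and> at_slope_point = ?c \<oplus>\<^bsub>?W\<^esub> tensor_scale K F ?B (poly_var A) w"
    \<comment> \<open>The shift is applied to the equation for w: it kills the constant and strips
      the factor T, leaving w.\<close>
    then have "?s at_slope_point = ?s (?c \<oplus>\<^bsub>?W\<^esub> tensor_scale K F ?B (poly_var A) w)" by simp
    also have "\<dots> = ?s ?c \<oplus>\<^bsub>?W\<^esub> ?s (tensor_scale K F ?B (poly_var A) w)"
      using w by (intro tensor_map_add[OF F m F m module_hom_id poly_shift_hom] tensor_const_closed[OF F A x]
          tensor_scale_closed[OF F B poly_var_closed[OF A]]) simp
    also have "\<dots> = w"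
      using w by (simp add: tensor_shift_const[OF F A x] tensor_shift_var[OF F A])
    finally show "w = ?s at_slope_point" by simp
  qed
  then show ?thesis
    unfolding slope_law_def slope_point_def Let_def by simp
qed

lemma slope_law_closed: "slope_law K E F P A z \<in> carrier (tensor_product K F A)"
proof -
  note m = algebra_is_module[OF A] algebra_is_module[OF poly_algebra_algebra[OF A]]
  show ?thesis
    unfolding slope_law_eq
    by (intro tensor_map_closed[OF F m(2) F m(1) module_hom_id]
        tensor_map_closed[OF F m(2) F m(2) module_hom_id poly_shift_hom at_slope_point_closed]
        algebra_hom_module_hom[OF poly_eval_hom(1)] A add_hom_closed[OF mor_t_hom[OF E A] z])
qed

lemma slope_law_increment:
  "P A (mor_x K E A z \<oplus>\<^bsub>tensor_product K E A\<^esub> tensor_scale K E A (mor_t A z) (mor_v K E A z))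
    = P A (mor_x K E A z) \<oplus>\<^bsub>tensor_product K F A\<^esub> tensor_scale K F A (mor_t A z) (slope_law K E F P A z)"
proof -
  let ?t = "mor_t A z"
  let ?ev = "\<lambda>M. tensor_map K M A id (poly_eval A ?t)"
  note B = poly_algebra_algebra[OF A]
  note m = algebra_is_module[OF A] algebra_is_module[OF B]
  note t = add_hom_closed[OF mor_t_hom[OF E A] z]
  note ev = poly_eval_hom[OF A t]
  note x = polynomial_law_closed[OF mor_x_law[OF E] A z]
  note v = polynomial_law_closed[OF mor_v_law[OF E] A z]
  note Px = polynomial_law_closed[OF P A x]
  note s = tensor_map_closed[OF F m(2) F m(2) module_hom_id poly_shift_hom at_slope_point_closed]
  \<comment> \<open>T = t is substituted in the argument of \<open>P\<close> here and in the
    decomposition of its value below; naturality of \<open>P\<close> equates the two.\<close>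
  have "?ev E (slope_point K E A z)
      = mor_x K E A z \<oplus>\<^bsub>tensor_product K E A\<^esub> tensor_scale K E A ?t (mor_v K E A z)"
    by (subst slope_point_hom[OF E A A ev(1) module_hom_id _ z])
      (simp_all add: ev(2,3) tensor_map_id[OF E m(1)] x v)
  then have "P A (mor_x K E A z \<oplus>\<^bsub>tensor_product K E A\<^esub> tensor_scale K E A ?t (mor_v K E A z))
      = ?ev F at_slope_point"
    using polynomial_law_natural[OF P B A ev(1) slope_point_closed[OF E A z]] by simp
  also have "\<dots> = ?ev F (tensor_map K F (poly_algebra A) id (poly_const A) (P A (mor_x K E A z)))
      \<oplus>\<^bsub>tensor_product K F A\<^esub> ?ev F (tensor_scale K F (poly_algebra A) (poly_var A)
        (tensor_map K F (poly_algebra A) id poly_shift at_slope_point))"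
    by (subst at_slope_point_decomp, rule tensor_map_add[OF F m(2) F m(1) module_hom_id
          algebra_hom_module_hom[OF ev(1)] tensor_const_closed[OF F A Px]
          tensor_scale_closed[OF F B poly_var_closed[OF A] s]])
  also have "?ev F (tensor_map K F (poly_algebra A) id (poly_const A) (P A (mor_x K E A z)))
      = tensor_map K F A id id (P A (mor_x K E A z))"
    by (rule tensor_map_compose_right[OF F m(1) m(2) m(1) algebra_hom_module_hom[OF poly_const_hom[OF A]]
          algebra_hom_module_hom[OF ev(1)] module_hom_id _ Px]) (simp add: ev(2))
  also have "\<dots> = P A (mor_x K E A z)" by (rule tensor_map_id[OF F m(1) Px])
  also have "?ev F (tensor_scale K F (poly_algebra A) (poly_var A)
        (tensor_map K F (poly_algebra A) id poly_shift at_slope_point))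
      = tensor_scale K F A ?t (slope_law K E F P A z)"
    unfolding slope_law_eq tensor_scale_natural[OF F B A ev(1) poly_var_closed[OF A] s] ev(3) ..
  finally show ?thesis .
qed

end

text \<open>Three squares are pasted together. \<open>P\<close> commutes with the coefficientwise
  extension A[T] \<rightarrow> C[T] of \<phi>, so does the shift, and substituting \<phi>(t) after
  this extension is \<phi> after substituting t.\<close>

lemma slope_law_law: "polynomial_law K (mor_module K E) F (slope_law K E F P)"
proof (rule polynomial_lawI)
  fix A :: "('k, 'x) test_algebra" and z
  assume "algebra K A" "z \<in> carrier (tensor_product K (mor_module K E) A)"
  then show "slope_law K E F P A z \<in> carrier (tensor_product K F A)" by (rule slope_law_closed)
next
  fix A C :: "('k, 'x) test_algebra" and \<phi> z
  assume A: "algebra K A" and C: "algebra K C" and h: "\<phi> \<in> algebra_hom K A C"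
    and z: "z \<in> carrier (tensor_product K (mor_module K E) A)"
  note B = poly_algebra_algebra[OF A]
  note D = poly_algebra_algebra[OF C]
  note mA = algebra_is_module[OF A] and mB = algebra_is_module[OF B]
    and mC = algebra_is_module[OF C] and mD = algebra_is_module[OF D]
  note hm = algebra_hom_module_hom[OF h]
  note pm = algebra_hom_module_hom[OF poly_map_hom[OF A C h]]
  note t = add_hom_closed[OF mor_t_hom[OF E A] z]
  note eA = algebra_hom_module_hom[OF poly_eval_hom(1)[OF A t]]
  note eC = algebra_hom_module_hom[OF poly_eval_hom(1)[OF C module_hom_closed[OF hm t]]]
  let ?z = "tensor_map K (mor_module K E) C id \<phi> z"
  let ?u = "P (poly_algebra A) (slope_point K E A z)"
  let ?s = "tensor_map K F (poly_algebra A) id poly_shift ?u"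
  note u = at_slope_point_closed[OF A z]
  note s = tensor_map_closed[OF F mB F mB module_hom_id poly_shift_hom u]
  have z': "?z \<in> carrier (tensor_product K (mor_module K E) C)"
    by (rule tensor_map_closed[OF mor_module_module[OF E] mA mor_module_module[OF E] mC module_hom_id hm z])
  have ps: "(\<lambda>p. poly_map \<phi> (poly_shift p)) \<in> module_hom K (poly_algebra A) (poly_algebra C)"
    using module_hom_compose[OF poly_shift_hom pm] by (simp add: o_def)
  have pe: "(\<lambda>p. \<phi> (poly_eval A (mor_t A z) p)) \<in> module_hom K (poly_algebra A) C"
    using module_hom_compose[OF eA hm] by (simp add: o_def)
  have "P (poly_algebra C) (slope_point K E C ?z) = tensor_map K F (poly_algebra C) id (poly_map \<phi>) ?u"
    unfolding slope_point_natural[OF E A C h z]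
    by (rule polynomial_law_natural[OF P B D poly_map_hom[OF A C h] slope_point_closed[OF E A z]])
  then have "tensor_map K F (poly_algebra C) id poly_shift (P (poly_algebra C) (slope_point K E C ?z))
      = tensor_map K F (poly_algebra C) id (\<lambda>p. poly_map \<phi> (poly_shift p)) ?u"
    using tensor_map_compose_right[OF F mB mD mD pm poly_shift_hom ps _ u]
    by (simp add: poly_map_shift[OF A C h])
  also have "\<dots> = tensor_map K F (poly_algebra C) id (poly_map \<phi>) ?s"
    by (rule tensor_map_compose_right[OF F mB mB mD poly_shift_hom pm ps refl u, symmetric])
  finally have "slope_law K E F P C ?z = tensor_map K F C id (poly_eval C (\<phi> (mor_t A z)))
      (tensor_map K F (poly_algebra C) id (poly_map \<phi>) ?s)"
    unfolding slope_law_eq[OF C z'] mor_t_natural[OF E A C h z] by simp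
  also have "\<dots> = tensor_map K F C id (\<lambda>p. \<phi> (poly_eval A (mor_t A z) p)) ?s"
    by (rule tensor_map_compose_right[OF F mB mD mC pm eC pe poly_eval_map[OF A C h t] s])
  also have "\<dots> = tensor_map K F C id \<phi> (tensor_map K F A id (poly_eval A (mor_t A z)) ?s)"
    by (rule tensor_map_compose_right[OF F mB mA mC eA hm pe refl s, symmetric])
  finally show "slope_law K E F P C ?z = tensor_map K F C id \<phi> (slope_law K E F P A z)"
    unfolding slope_law_eq[OF A z] .
qed

lemma mor_law_law: "polynomial_law K (mor_module K E) (mor_module K F) (mor_law K E F P)"
proof -
  have S: "module K (scal_module K)" by (rule scal_module_module[OF module_cring[OF E]])
  show ?thesis
    unfolding mor_law_def mor_module_def[of K F]
    by (intro law_pair_law F S prod_module_module law_comp_law[OF mor_x_law[OF E] P] slope_law_law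
        mor_k_law E)
qed

end

section \<open>The underlying map of a polynomial law\<close>

text \<open>The isomorphism M \<cong> M \<otimes> K behind \<open>law_map\<close>; its inverse is
  \<open>tensor_base\<close> below.\<close>

abbreviation point_tensor :: "'k ring \<Rightarrow> ('k, 'm) module \<Rightarrow> 'm \<Rightarrow> ('m, ('k, 'x) test) tensor" where
  "point_tensor K M x \<equiv> pure_tensor K M (base_algebra K) x (Const \<one>\<^bsub>K\<^esub>)"

abbreviation tensor_base :: "('k, 'm) module \<Rightarrow> ('m, ('k, 'x) test) tensor \<Rightarrow> 'm" where
  "tensor_base M \<equiv> tensor_lift M (\<lambda>y c. const_val c \<odot>\<^bsub>M\<^esub> y)"

lemma base_algebra_simps:
  "carrier (base_algebra K) = Const ` carrier K"
  "Const a \<oplus>\<^bsub>base_algebra K\<^esub> Const b = Const (a \<oplus>\<^bsub>K\<^esub> b)"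
  "Const a \<otimes>\<^bsub>base_algebra K\<^esub> Const b = Const (a \<otimes>\<^bsub>K\<^esub> b)"
  "k \<odot>\<^bsub>base_algebra K\<^esub> Const a = Const (k \<otimes>\<^bsub>K\<^esub> a)"
  by (simp_all add: base_algebra_def)

text \<open>\<open>K\<close> and \<open>M\<close> do not determine the type of test algebras. The
  variable \<open>base\<close> pins it down in all statements of this block.\<close>

context
  fixes K :: "'k ring" and M :: "('k, 'm) module" and base :: "('k, 'x) test_algebra"
  assumes M: "module K M" and base: "base = base_algebra K"
begin

interpretation M: module K M by (rule M)

lemma base_algebra: "algebra K base"
  unfolding base by (rule base_algebra_algebra[OF M.is_cring])

lemma base_module: "module K base"
  by (rule algebra_is_module[OF base_algebra])

lemma base_one: "Const \<one>\<^bsub>K\<^esub> \<in> carrier base"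
  by (simp add: base base_algebra_simps)

lemma tensor_base_balanced:
  "balanced K M base M (\<lambda>y c. const_val c \<odot>\<^bsub>M\<^esub> y)"
  unfolding balanced_def base
  by (auto simp: base_algebra_simps M.smult_l_distr M.smult_r_distr M.smult_assoc1 M.m_comm
      simp flip: M.smult_assoc1)

lemma tensor_base_hom: "tensor_base M \<in> add_hom (tensor_product K M base) M"
  by (rule tensor_lift_hom[OF M base_module module_abelian_group[OF M] tensor_base_balanced])

lemma tensor_base_point: "x \<in> carrier M \<Longrightarrow> tensor_base M (pure_tensor K M base x (Const \<one>\<^bsub>K\<^esub>)) = x"
  by (simp add: tensor_lift_pure[OF M base_module module_abelian_group[OF M] tensor_base_balanced] base_one)

lemma point_tensor_hom:
  "(\<lambda>x. pure_tensor K M base x (Const \<one>\<^bsub>K\<^esub>)) \<in> add_hom M (tensor_product K M base)"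
  by (rule add_homI)
    (simp_all add: pure_tensor_closed pure_tensor_add_left M base_module base_one)

text \<open>On pure tensors, x \<otimes> c = x \<otimes> c1 = cx \<otimes> 1. Hence every tensor
  over the base algebra has the form y \<otimes> 1.\<close>

lemma point_tensor_base:
  assumes "z \<in> carrier (tensor_product K M base)"
  shows "pure_tensor K M base (tensor_base M z) (Const \<one>\<^bsub>K\<^esub>) = z"
proof (rule tensor_hom_ext[where g = "\<lambda>z. z", OF M base_module tensor_abelian_group[OF M base_module]
      add_hom_compose[OF tensor_base_hom point_tensor_hom] _ _ assms])
  fix x a
  assume x: "x \<in> carrier M" and a: "a \<in> carrier base"
  then obtain c where c: "a = Const c" "c \<in> carrier K" by (auto simp: base base_algebra_simps)
  have "c \<odot>\<^bsub>base\<^esub> Const \<one>\<^bsub>K\<^esub> = Const c" using c by (simp add: base base_algebra_simps)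
  then show "pure_tensor K M base (tensor_base M (pure_tensor K M base x a)) (Const \<one>\<^bsub>K\<^esub>)
      = pure_tensor K M base x a"
    using x a c pure_tensor_balanced[OF M base_module x base_one c(2)]
    by (simp add: tensor_lift_pure[OF M base_module module_abelian_group[OF M] tensor_base_balanced])
qed (rule add_homI; simp)

lemma tensor_scale_point:
  assumes "t \<in> carrier K" "x \<in> carrier M"
  shows "tensor_scale K M base (Const t) (pure_tensor K M base x (Const \<one>\<^bsub>K\<^esub>))
    = pure_tensor K M base (t \<odot>\<^bsub>M\<^esub> x) (Const \<one>\<^bsub>K\<^esub>)"
proof -
  have t: "Const t \<in> carrier base" using assms(1) by (simp add: base base_algebra_simps)
  have "tensor_scale K M base (Const t) (pure_tensor K M base x (Const \<one>\<^bsub>K\<^esub>))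
      = pure_tensor K M base x (Const t \<otimes>\<^bsub>base\<^esub> Const \<one>\<^bsub>K\<^esub>)"
    unfolding tensor_scale_def
    by (simp add: tensor_map_pure[OF M base_module M base_module module_hom_id
          mult_module_hom[OF base_algebra t]] assms base_one)
  also have "Const t \<otimes>\<^bsub>base\<^esub> Const \<one>\<^bsub>K\<^esub> = t \<odot>\<^bsub>base\<^esub> Const \<one>\<^bsub>K\<^esub>"
    by (simp add: base base_algebra_simps)
  finally show ?thesis
    using pure_tensor_balanced[OF M base_module assms(2) base_one assms(1)] by simp
qed

end

lemma point_tensor_closed:
  assumes "module K M" "x \<in> carrier M"
  shows "point_tensor K M x \<in> carrier (tensor_product K M (base_algebra K :: ('k, 'x) test_algebra))"
  by (rule add_hom_closed[OF point_tensor_hom[OF assms(1) refl] assms(2)])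

lemma law_map_closed:
  fixes P :: "('k, 'x, 'm, 'n) law"
  assumes M: "module K M" and N: "module K N" and P: "polynomial_law K M N P" and x: "x \<in> carrier M"
  shows "law_map K M N P x \<in> carrier N"
  unfolding law_map_def
  by (rule add_hom_closed[OF tensor_base_hom[OF N refl]
        polynomial_law_closed[OF P base_algebra[OF M refl] point_tensor_closed[OF M x]]])

text \<open>Lets a point be pushed through a composite of laws without unfolding
  \<open>law_map\<close> at each stage; \<open>law_map_eqI\<close> then reads off the
  result.\<close>

lemma law_at_point:
  fixes P :: "('k, 'x, 'm, 'n) law"
  assumes M: "module K M" and N: "module K N" and P: "polynomial_law K M N P" and x: "x \<in> carrier M"
  shows "P (base_algebra K) (point_tensor K M x) = point_tensor K N (law_map K M N P x)"
  unfolding law_map_def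
  by (rule point_tensor_base[OF N refl
        polynomial_law_closed[OF P base_algebra[OF M refl] point_tensor_closed[OF M x]], symmetric])

lemma law_map_eqI:
  fixes P :: "('k, 'x, 'm, 'n) law"
  assumes N: "module K N" and y: "y \<in> carrier N"
    and "P (base_algebra K) (point_tensor K M x) = point_tensor K N y"
  shows "law_map K M N P x = y"
  unfolding law_map_def assms(3) by (rule tensor_base_point[OF N refl y])

lemma point_tensor_inject:
  assumes "module K M" "x \<in> carrier M" "y \<in> carrier M"
    and "(point_tensor K M x :: ('m, ('k, 'x) test) tensor) = point_tensor K M y"
  shows "x = y"
  using arg_cong[OF assms(4), of "tensor_base M"]
  by (simp add: tensor_base_point[OF assms(1) refl] assms(2,3))

lemma point_tensor_add:
  assumes "module K M" "x \<in> carrier M" "y \<in> carrier M"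
  shows "point_tensor K M x \<oplus>\<^bsub>tensor_product K M (base_algebra K :: ('k, 'x) test_algebra)\<^esub> point_tensor K M y
    = point_tensor K M (x \<oplus>\<^bsub>M\<^esub> y)"
  by (rule add_hom_add[OF point_tensor_hom[OF assms(1) refl] assms(2,3), symmetric])

lemma linear_law_point:
  assumes "module K M" "module K N" "f \<in> module_hom K M N" "x \<in> carrier M"
  shows "linear_law K N f (base_algebra K :: ('k, 'x) test_algebra) (point_tensor K M x) = point_tensor K N (f x)"
  unfolding linear_law_def
  by (simp add: tensor_map_pure[OF assms(1) base_module[OF assms(1) refl] assms(2) base_module[OF assms(1) refl]
        assms(3) module_hom_id assms(4) base_one[OF assms(1) refl]])

lemma law_pair_point:
  assumes E: "module K E" and F: "module K F" and x: "x \<in> carrier E" and y: "y \<in> carrier F"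
    and P: "P (base_algebra K :: ('k, 'x) test_algebra) z = point_tensor K E x"
    and Q: "Q (base_algebra K) z = point_tensor K F y"
  shows "law_pair K E F P Q (base_algebra K) z = point_tensor K (prod_module E F) \<langle>x, y\<rangle>"
proof -
  interpret E: module K E by fact
  interpret F: module K F by fact
  have "\<langle>x, \<zero>\<^bsub>F\<^esub>\<rangle> \<in> carrier (prod_module E F)" "\<langle>\<zero>\<^bsub>E\<^esub>, y\<rangle> \<in> carrier (prod_module E F)"
    using x y by (auto simp: prod_module_def)
  then show ?thesis
    unfolding law_pair_def P Q
    by (simp add: linear_law_point[OF E prod_module_module[OF E F] pair_left_module_hom[OF F] x]
        linear_law_point[OF F prod_module_module[OF E F] pair_right_module_hom[OF E] y]
        point_tensor_add[OF prod_module_module[OF E F]])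
      (simp add: prod_module_def x y)
qed

context
  fixes K :: "'k ring" and E :: "('k, 'v) pmodule" and base :: "('k, 'x) test_algebra"
    and x v :: "('k, 'v) point" and t :: 'k
  assumes E: "module K E" and base: "base = base_algebra K"
    and x: "x \<in> carrier E" and v: "v \<in> carrier E" and t: "t \<in> carrier K"
begin

abbreviation (input) "xvt \<equiv> pure_tensor K (mor_module K E) base \<langle>x, \<langle>v, Scal t\<rangle>\<rangle> (Const \<one>\<^bsub>K\<^esub>)"

lemma mor_components_point:
  shows mor_x_point: "mor_x K E base xvt = pure_tensor K E base x (Const \<one>\<^bsub>K\<^esub>)"
    and mor_v_point: "mor_v K E base xvt = pure_tensor K E base v (Const \<one>\<^bsub>K\<^esub>)"
    and mor_k_point: "mor_k K base xvt = pure_tensor K (scal_module K) base (Scal t) (Const \<one>\<^bsub>K\<^esub>)"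
    and mor_t_point: "mor_t base xvt = Const t"
proof -
  interpret E: module K E by (rule E)
  note p = mor_module_carrier[of x v t K E, THEN iffD2, OF conjI[OF x conjI[OF v t]]]
  note M = mor_module_module[OF E]
  show "mor_x K E base xvt = pure_tensor K E base x (Const \<one>\<^bsub>K\<^esub>)"
    unfolding mor_x_def base by (simp add: linear_law_point[OF M E mor_x_module_hom p])
  show "mor_v K E base xvt = pure_tensor K E base v (Const \<one>\<^bsub>K\<^esub>)"
    unfolding mor_v_def base by (simp add: linear_law_point[OF M E mor_v_module_hom p])
  show "mor_k K base xvt = pure_tensor K (scal_module K) base (Scal t) (Const \<one>\<^bsub>K\<^esub>)"
    unfolding mor_k_def base
    by (simp add: linear_law_point[OF M scal_module_module[OF module_cring[OF E]] mor_k_module_hom p])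
  show "mor_t base xvt = Const t"
    by (simp add: mor_t_pure[OF E base_algebra[OF E base] p base_one[OF E base]])
      (simp add: base base_algebra_simps t)
qed

lemma translation_point:
  "mor_x K E base xvt \<oplus>\<^bsub>tensor_product K E base\<^esub> tensor_scale K E base (mor_t base xvt) (mor_v K E base xvt)
    = pure_tensor K E base (x \<oplus>\<^bsub>E\<^esub> t \<odot>\<^bsub>E\<^esub> v) (Const \<one>\<^bsub>K\<^esub>)"
proof -
  interpret E: module K E by (rule E)
  show ?thesis
    unfolding mor_components_point tensor_scale_point[OF E base t v] unfolding base
    by (rule point_tensor_add[OF E x]) (simp add: t v)
qed

end

section \<open>Maps on points for new edges, old edges and copies\<close>

lemma new_edge_tgt_map:
  fixes K :: "'k ring" and E :: "('k, 'v) pmodule"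
  assumes E: "module K E" and x: "x \<in> carrier E" and v: "v \<in> carrier E" and t: "t \<in> carrier K"
  shows "law_map K (mor_module K E) (obj_module K E)
      (tgt (new_edge K E :: ('k, 'v, 'x) groupoid_laws)) \<langle>x, \<langle>v, Scal t\<rangle>\<rangle>
    = \<langle>x \<oplus>\<^bsub>E\<^esub> t \<odot>\<^bsub>E\<^esub> v, Scal t\<rangle>"
proof -
  interpret E: module K E by (rule E)
  have y: "x \<oplus>\<^bsub>E\<^esub> t \<odot>\<^bsub>E\<^esub> v \<in> carrier E" using x v t by simp
  have s: "Scal t \<in> carrier (scal_module K)" using t by (simp add: scal_module_def)
  show ?thesis
    unfolding new_edge_def groupoid_laws.simps
    by (rule law_map_eqI[OF obj_module_module[OF E]], simp add: obj_module_carrier y t)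
      (simp add: obj_module_def law_pair_point[OF E scal_module_module[OF module_cring[OF E]] y s]
        translation_point[OF E refl x v t] mor_k_point[OF E refl x v t])
qed

lemma obj_law_map:
  fixes P :: "('k, 'v, 'x) plaw"
  assumes E: "module K E" and F: "module K F" and P: "polynomial_law K E F P"
    and x: "x \<in> carrier E" and t: "t \<in> carrier K"
  shows "law_map K (obj_module K E) (obj_module K F) (obj_law K E F P) \<langle>x, Scal t\<rangle>
    = \<langle>law_map K E F P x, Scal t\<rangle>"
proof -
  have S: "module K (scal_module K)" by (rule scal_module_module[OF module_cring[OF E]])
  note y = law_map_closed[OF E F P x]
  have s: "Scal t \<in> carrier (scal_module K)" using t by (simp add: scal_module_def)
  have p: "\<langle>x, Scal t\<rangle> \<in> carrier (prod_module E (scal_module K))"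
    using x s by (simp add: prod_module_def)
  note ES = prod_module_module[OF E S]
  show ?thesis
    by (rule law_map_eqI[OF obj_module_module[OF F]], simp add: obj_module_carrier y t)
      (simp add: obj_law_def obj_module_def law_pair_point[OF F S y s] law_comp_def
        linear_law_point[OF ES E pfst_module_hom p] linear_law_point[OF ES S psnd_module_hom p]
        law_at_point[OF E F P x])
qed

text \<open>Matches the law of a copied edge with the formula in \<open>ext_map\<close>. The middle
  component remains the value of a law, since it depends on \<open>P\<close> and not only on its map
  on points.\<close>

lemma mor_law_map:
  fixes P :: "('k, 'v, 'x) plaw"
  assumes E: "module K E" and F: "module K F" and P: "polynomial_law K E F P"
    and x: "x \<in> carrier E" and v: "v \<in> carrier E" and t: "t \<in> carrier K"
  shows "law_map K (mor_module K E) (mor_module K F) (mor_law K E F P) \<langle>x, \<langle>v, Scal t\<rangle>\<rangle>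
    = \<langle>law_map K E F P x,
       \<langle>law_map K (mor_module K E) F (slope_law K E F P) \<langle>x, \<langle>v, Scal t\<rangle>\<rangle>, Scal t\<rangle>\<rangle>"
proof -
  have S: "module K (scal_module K)" by (rule scal_module_module[OF module_cring[OF E]])
  have p: "\<langle>x, \<langle>v, Scal t\<rangle>\<rangle> \<in> carrier (mor_module K E)"
    by (simp add: mor_module_carrier x v t)
  note sl = slope_law_law[OF E F P]
  note y = law_map_closed[OF E F P x]
  note w = law_map_closed[OF mor_module_module[OF E] F sl p]
  have s: "Scal t \<in> carrier (scal_module K)" using t by (simp add: scal_module_def)
  have ws: "\<langle>law_map K (mor_module K E) F (slope_law K E F P) \<langle>x, \<langle>v, Scal t\<rangle>\<rangle>, Scal t\<rangle>
      \<in> carrier (prod_module F (scal_module K))"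
    using w s by (simp add: prod_module_def)
  show ?thesis
    by (rule law_map_eqI[OF mor_module_module[OF F]], simp add: mor_module_carrier y w t)
      (simp add: mor_law_def mor_module_def[of K F] law_pair_point[OF F prod_module_module[OF F S] y ws]
        law_pair_point[OF F S w s] law_comp_def mor_x_point[OF E refl x v t] mor_k_point[OF E refl x v t]
        law_at_point[OF E F P x] law_at_point[OF mor_module_module[OF E] F sl p])
qed

text \<open>The increment formula over the base algebra at (x, v, t) \<otimes> 1, pulled back along
  the injective map y |-> y \<otimes> 1. There is no division by t, which may be a zero
  divisor.\<close>

lemma slope_law_map_increment:
  fixes P :: "('k, 'v, 'x) plaw"
  assumes E: "module K E" and F: "module K F" and P: "polynomial_law K E F P"
    and x: "x \<in> carrier E" and v: "v \<in> carrier E" and t: "t \<in> carrier K"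
  shows "law_map K E F P (x \<oplus>\<^bsub>E\<^esub> t \<odot>\<^bsub>E\<^esub> v)
    = law_map K E F P x
      \<oplus>\<^bsub>F\<^esub> t \<odot>\<^bsub>F\<^esub> law_map K (mor_module K E) F (slope_law K E F P) \<langle>x, \<langle>v, Scal t\<rangle>\<rangle>"
proof -
  interpret E: module K E by (rule E)
  interpret F: module K F by (rule F)
  let ?base = "base_algebra K :: ('k, 'x) test_algebra"
  have p: "\<langle>x, \<langle>v, Scal t\<rangle>\<rangle> \<in> carrier (mor_module K E)"
    by (simp add: mor_module_carrier x v t)
  have q: "x \<oplus>\<^bsub>E\<^esub> t \<odot>\<^bsub>E\<^esub> v \<in> carrier E" using x v t by simp
  note M = mor_module_module[OF E]
  note sl = slope_law_law[OF E F P]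
  note y = law_map_closed[OF E F P x]
  note w = law_map_closed[OF M F sl p]
  have "point_tensor K F (law_map K E F P (x \<oplus>\<^bsub>E\<^esub> t \<odot>\<^bsub>E\<^esub> v))
      = P ?base (point_tensor K E (x \<oplus>\<^bsub>E\<^esub> t \<odot>\<^bsub>E\<^esub> v))"
    by (rule law_at_point[OF E F P q, symmetric])
  also have "\<dots> = point_tensor K F (law_map K E F P x) \<oplus>\<^bsub>tensor_product K F ?base\<^esub>
      tensor_scale K F ?base (Const t)
        (point_tensor K F (law_map K (mor_module K E) F (slope_law K E F P) \<langle>x, \<langle>v, Scal t\<rangle>\<rangle>))"
    using slope_law_increment[OF E F P base_algebra[OF E refl] point_tensor_closed[OF M p]]
    unfolding translation_point[OF E refl x v t] unfolding mor_x_point[OF E refl x v t] mor_t_point[OF E refl x v t]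
      law_at_point[OF E F P x] law_at_point[OF M F sl p] .
  also have "\<dots> = point_tensor K F (law_map K E F P x
      \<oplus>\<^bsub>F\<^esub> t \<odot>\<^bsub>F\<^esub> law_map K (mor_module K E) F (slope_law K E F P) \<langle>x, \<langle>v, Scal t\<rangle>\<rangle>)"
    unfolding tensor_scale_point[OF F refl t w]
    by (rule point_tensor_add[OF F y]) (simp add: t w)
  finally show ?thesis
    by (rule point_tensor_inject[OF F law_map_closed[OF E F P q], rotated]) (simp add: y w t)
qed

section \<open>The target projections\<close>

text \<open>The fold runs through the labels in increasing order, so the step of the largest label
  comes last and is outermost.\<close>

lemma nfold_groupoid_of_Max:
  assumes "finite N" "N \<noteq> {}"
  shows "nfold_groupoid_of K N L = groupoid_step K (Max N) (nfold_groupoid_of K (N - {Max N}) L)"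
proof -
  have "sorted_list_of_set N = sorted_list_of_set (N - {Max N}) @ [Max N]"
  proof (rule sorted_distinct_set_unique)
    show "sorted (sorted_list_of_set (N - {Max N}) @ [Max N])"
      using assms by (auto simp: sorted_append)
  qed (simp_all add: assms insert_absorb[OF Max_in[OF assms]])
  then show ?thesis by (simp add: nfold_groupoid_of_def)
qed

lemma groupoid_step_simps:
  "a \<in> \<alpha> \<Longrightarrow> vset (groupoid_step K a C) \<alpha> = mor_set K (amb C (\<alpha> - {a})) (vset C (\<alpha> - {a}))"
  "a \<notin> \<alpha> \<Longrightarrow> vset (groupoid_step K a C) \<alpha> = obj_set K (vset C \<alpha>)"
  "a \<in> \<alpha> \<Longrightarrow> amb (groupoid_step K a C) \<alpha> = mor_module K (amb C (\<alpha> - {a}))"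
  "a \<notin> \<alpha> \<Longrightarrow> amb (groupoid_step K a C) \<alpha> = obj_module K (amb C \<alpha>)"
  "a \<in> \<beta> \<Longrightarrow> edge (groupoid_step K a C) \<beta> \<alpha>
     = copy_edge K (amb C (\<alpha> - {a})) (amb C (\<beta> - {a})) (edge C (\<beta> - {a}) (\<alpha> - {a}))"
  "a \<notin> \<beta> \<Longrightarrow> a \<in> \<alpha> \<Longrightarrow> edge (groupoid_step K a C) \<beta> \<alpha> = new_edge K (amb C \<beta>)"
  "a \<notin> \<beta> \<Longrightarrow> a \<notin> \<alpha> \<Longrightarrow> edge (groupoid_step K a C) \<beta> \<alpha>
     = old_edge K (amb C \<alpha>) (amb C \<beta>) (edge C \<beta> \<alpha>)"
  by (simp_all add: groupoid_step_def)

lemma edge_tgt_simps: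
  "tgt (old_edge K M O' g) = obj_law K M O' (tgt g)"
  "tgt (copy_edge K M O' g) = mor_law K M O' (tgt g)"
  by (simp_all add: old_edge_def copy_edge_def)

section \<open>Linear sets and the laws between them\<close>

definition subset_of_module :: "'k ring \<Rightarrow> ('k, 'v) pmodule \<Rightarrow> ('k, 'v) point set \<Rightarrow> bool" where
  "subset_of_module K E X \<longleftrightarrow> module K E \<and> X \<subseteq> carrier E"

text \<open>What the induction carries for an edge. It speaks of the law alone; the projection is
  recovered from it by restriction.\<close>

definition law_restricts ::
  "'k ring \<Rightarrow> ('k, 'v) pmodule \<Rightarrow> ('k, 'v) point set \<Rightarrow> ('k, 'v) pmodule \<Rightarrow> ('k, 'v) point set
   \<Rightarrow> ('k, 'v, 'x) plaw \<Rightarrow> bool" where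
  "law_restricts K E X F Y P \<longleftrightarrow> polynomial_law K E F P \<and> (\<forall>x\<in>X. law_map K E F P x \<in> Y)"

lemma obj_subset: "subset_of_module K E X \<Longrightarrow> subset_of_module K (obj_module K E) (obj_set K X)"
  by (auto simp: subset_of_module_def obj_module_module obj_set_def obj_module_carrier)

lemma mor_subset: "subset_of_module K E X \<Longrightarrow> subset_of_module K (mor_module K E) (mor_set K E X)"
  by (auto simp: subset_of_module_def mor_module_module mor_set_def mor_module_carrier)

text \<open>That the endpoint x + tv lies in X is part of being a morphism.\<close>

lemma new_edge_restricts:
  assumes "subset_of_module K E X"
  shows "law_restricts K (mor_module K E) (mor_set K E X) (obj_module K E) (obj_set K X) (tgt (new_edge K E))"
  using assms
  by (auto simp: subset_of_module_def law_restricts_def new_edge_tgt_law mor_set_def obj_set_def new_edge_tgt_map)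

lemma obj_law_restricts:
  assumes "subset_of_module K E X" "subset_of_module K F Y" "law_restricts K E X F Y P"
  shows "law_restricts K (obj_module K E) (obj_set K X) (obj_module K F) (obj_set K Y) (obj_law K E F P)"
  using assms
  by (auto simp: subset_of_module_def law_restricts_def obj_law_law obj_set_def obj_law_map subset_iff)

lemma mor_law_restricts:
  assumes X: "subset_of_module K E X" and Y: "subset_of_module K F Y" and P: "law_restricts K E X F Y P"
  shows "law_restricts K (mor_module K E) (mor_set K E X) (mor_module K F) (mor_set K F Y) (mor_law K E F P)"
proof -
  have E: "module K E" and F: "module K F" and XE: "X \<subseteq> carrier E"
    and law: "polynomial_law K E F P" and into: "\<And>x. x \<in> X \<Longrightarrow> law_map K E F P x \<in> Y"
    using assms by (auto simp: subset_of_module_def law_restricts_def)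
  have "law_map K (mor_module K E) (mor_module K F) (mor_law K E F P) p \<in> mor_set K F Y"
    if pX: "p \<in> mor_set K E X" for p
  proof -
    obtain x v t where p: "p = \<langle>x, \<langle>v, Scal t\<rangle>\<rangle>" "x \<in> X" "v \<in> carrier E" "t \<in> carrier K"
      "x \<oplus>\<^bsub>E\<^esub> t \<odot>\<^bsub>E\<^esub> v \<in> X" using pX unfolding mor_set_def by blast
    then have x: "x \<in> carrier E" using XE by auto
    have "p \<in> carrier (mor_module K E)" using p x by (simp add: mor_module_carrier)
    note w = law_map_closed[OF mor_module_module[OF E] F slope_law_law[OF E F law] this]
    \<comment> \<open>\<open>into\<close> is needed at both ends: at x for the source of the image,
      and at x + tv for its target, which the increment formula identifies.\<close>
    show ?thesis
      using mor_law_map[OF E F law x p(3,4)] into[OF p(2)] w p(4)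
        into[OF p(5)] slope_law_map_increment[OF E F law x p(3,4)] p(1)
      by (auto simp: mor_set_def)
  qed
  then show ?thesis by (simp add: law_restricts_def mor_law_law[OF E F law])
qed

text \<open>All edges are treated together, since an old edge refers to the same edge without the
  new label and a copy to the edge with that label removed at both ends. Edges are limited to
  \<alpha> \<subseteq> N because those beyond N would be built from the undefined edges of the
  0-fold groupoid.\<close>

lemma nfold_groupoid_properties:
  fixes K :: "'k ring" and L :: "('k, 'v) linear_set"
  assumes L: "subset_of_module K (snd L) (fst L)" and "finite N"
  defines "C \<equiv> (nfold_groupoid_of K N L :: ('k, 'v, 'x) nfold_groupoid)"
  shows "(\<forall>\<alpha>. subset_of_module K (amb C \<alpha>) (vset C \<alpha>)) \<and>
    (\<forall>\<alpha> i. \<alpha> \<subseteq> N \<longrightarrow> i \<in> \<alpha> \<longrightarrow>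
      law_restricts K (amb C \<alpha>) (vset C \<alpha>) (amb C (\<alpha> - {i})) (vset C (\<alpha> - {i})) (tgt (edge C (\<alpha> - {i}) \<alpha>)))"
  using assms(2) unfolding C_def
proof (induction N rule: finite_linorder_max_induct)
  case empty
  then show ?case using L by (simp add: nfold_groupoid_of_def zerofold_def)
next
  case (insert a N)
  let ?C = "nfold_groupoid_of K N L :: ('k, 'v, 'x) nfold_groupoid"
  have a: "a \<notin> N" using insert by auto
  have "Max (insert a N) = a"
    using insert by (intro Max_eqI) (auto intro: less_imp_le)
  then have C: "nfold_groupoid_of K (insert a N) L = groupoid_step K a ?C"
    using nfold_groupoid_of_Max[of "insert a N" K L] insert.hyps(1) a by simp
  have X: "subset_of_module K (amb ?C \<alpha>) (vset ?C \<alpha>)" for \<alpha> using insert.IH by blast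
  have P: "law_restricts K (amb ?C \<alpha>) (vset ?C \<alpha>) (amb ?C (\<alpha> - {i})) (vset ?C (\<alpha> - {i}))
      (tgt (edge ?C (\<alpha> - {i}) \<alpha>))" if "\<alpha> \<subseteq> N" "i \<in> \<alpha>" for \<alpha> i
    using insert.IH that by blast
  show ?case
    unfolding C
  proof (intro conjI allI impI)
    fix \<alpha>
    show "subset_of_module K (amb (groupoid_step K a ?C) \<alpha>) (vset (groupoid_step K a ?C) \<alpha>)"
      by (cases "a \<in> \<alpha>") (simp_all add: groupoid_step_simps obj_subset mor_subset X)
  next
    fix \<alpha> i
    assume \<alpha>: "\<alpha> \<subseteq> insert a N" and i: "i \<in> \<alpha>"
    let ?R = "law_restricts K (amb (groupoid_step K a ?C) \<alpha>) (vset (groupoid_step K a ?C) \<alpha>)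
      (amb (groupoid_step K a ?C) (\<alpha> - {i})) (vset (groupoid_step K a ?C) (\<alpha> - {i}))
      (tgt (edge (groupoid_step K a ?C) (\<alpha> - {i}) \<alpha>))"
    \<comment> \<open>The new label is absent from both ends of the edge, or is the one removed, or
      survives at both ends.\<close>
    consider (old) "a \<notin> \<alpha>" | (new) "i = a" | (copy) "a \<in> \<alpha>" "i \<noteq> a" by blast
    then show ?R
    proof cases
      case old
      then show ?thesis
        using \<alpha> i by (simp add: groupoid_step_simps edge_tgt_simps) (intro obj_law_restricts X P; blast)
    next
      case new
      then show ?thesis
        using i by (simp add: groupoid_step_simps new_edge_restricts X)
    next
      case copy
      \<comment> \<open>A copy is built from the edge with a removed at both ends; this brings its
        object end into the form required by the induction hypothesis.\<close>
      have eq: "\<alpha> - {i} - {a} = \<alpha> - {a} - {i}" by blast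
      show ?thesis
        using copy \<alpha> i by (simp add: groupoid_step_simps edge_tgt_simps eq) (intro mor_law_restricts X P; blast)
    qed
  qed
qed

section \<open>The effect of one more label on a target projection\<close>

lemma nfold_groupoid_of_singleton: "nfold_groupoid_of K {a} L = groupoid_step K a (zerofold L)"
  by (simp add: nfold_groupoid_of_def)

lemma zerofold_simps: "vset (zerofold L) \<alpha> = fst L" "amb (zerofold L) \<alpha> = snd L"
  by (simp_all add: zerofold_def)

text \<open>The identity of laws is the definition of the step. For the maps, both sides are
  restricted to the same set, on which the law is evaluated at pairs (x, t).\<close>

lemma target_proj_old_edge:
  assumes a: "a \<notin> \<alpha>" "a \<notin> \<beta>" and X: "subset_of_module K (amb C \<alpha>) (vset C \<alpha>)"
    and Y: "subset_of_module K (amb C \<beta>) (vset C \<beta>)"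
    and P: "law_restricts K (amb C \<alpha>) (vset C \<alpha>) (amb C \<beta>) (vset C \<beta>) (tgt (edge C \<beta> \<alpha>))"
  shows "target_proj K (groupoid_step K a C) \<beta> \<alpha> = times_id K (vset C \<alpha>) (target_proj K C \<beta> \<alpha>) \<and>
    tgt (edge (groupoid_step K a C) \<beta> \<alpha>) = obj_law K (amb C \<alpha>) (amb C \<beta>) (tgt (edge C \<beta> \<alpha>))"
proof (intro conjI)
  show "target_proj K (groupoid_step K a C) \<beta> \<alpha> = times_id K (vset C \<alpha>) (target_proj K C \<beta> \<alpha>)"
    using a X Y P unfolding target_proj_def times_id_def
    by (auto simp: groupoid_step_simps edge_tgt_simps obj_set_def obj_law_map subset_of_module_def
        law_restricts_def subset_iff intro!: restrict_ext)
qed (use a in \<open>simp add: groupoid_step_simps edge_tgt_simps\<close>)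

text \<open>The right-hand side is formed from the stored law of the smaller edge, because
  \<open>target_proj\<close> alone does not determine a difference quotient.\<close>

lemma target_proj_copy_edge:
  assumes a: "a \<in> \<alpha>" "a \<in> \<beta>" and X: "subset_of_module K (amb C (\<alpha> - {a})) (vset C (\<alpha> - {a}))"
    and Y: "subset_of_module K (amb C (\<beta> - {a})) (vset C (\<beta> - {a}))"
    and P: "law_restricts K (amb C (\<alpha> - {a})) (vset C (\<alpha> - {a})) (amb C (\<beta> - {a})) (vset C (\<beta> - {a}))
      (tgt (edge C (\<beta> - {a}) (\<alpha> - {a})))"
  shows "target_proj K (groupoid_step K a C) \<beta> \<alpha>
      = ext_map K (amb C (\<alpha> - {a})) (amb C (\<beta> - {a})) (vset C (\<alpha> - {a}))
          (tgt (edge C (\<beta> - {a}) (\<alpha> - {a}))) \<and>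
    tgt (edge (groupoid_step K a C) \<beta> \<alpha>)
      = mor_law K (amb C (\<alpha> - {a})) (amb C (\<beta> - {a})) (tgt (edge C (\<beta> - {a}) (\<alpha> - {a})))"
proof (intro conjI)
  show "target_proj K (groupoid_step K a C) \<beta> \<alpha>
      = ext_map K (amb C (\<alpha> - {a})) (amb C (\<beta> - {a})) (vset C (\<alpha> - {a}))
          (tgt (edge C (\<beta> - {a}) (\<alpha> - {a})))"
    using a X Y P unfolding target_proj_def ext_map_def
    by (auto simp: groupoid_step_simps edge_tgt_simps mor_set_def mor_law_map subset_of_module_def
        law_restricts_def subset_iff intro!: restrict_ext)
qed (use a in \<open>simp add: groupoid_step_simps edge_tgt_simps\<close>)

text \<open>Written as an explicit function of the linear set at the lower vertex, so that it can be
  matched with the groupoid of a single label on the same linear set.\<close>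

lemma target_proj_new_edge:
  assumes X: "subset_of_module K (amb C (\<alpha> - {a})) (vset C (\<alpha> - {a}))" and a: "a \<in> \<alpha>"
  defines "E \<equiv> amb C (\<alpha> - {a})"
  shows "target_proj K (groupoid_step K a C) (\<alpha> - {a}) \<alpha>
      = (\<lambda>p \<in> mor_set K E (vset C (\<alpha> - {a})). \<langle>pfst p \<oplus>\<^bsub>E\<^esub> scal (psnd (psnd p)) \<odot>\<^bsub>E\<^esub> pfst (psnd p), psnd (psnd p)\<rangle>)"
    and "tgt (edge (groupoid_step K a C) (\<alpha> - {a}) \<alpha>) = tgt (new_edge K E)"
proof -
  show "target_proj K (groupoid_step K a C) (\<alpha> - {a}) \<alpha>
      = (\<lambda>p \<in> mor_set K E (vset C (\<alpha> - {a})). \<langle>pfst p \<oplus>\<^bsub>E\<^esub> scal (psnd (psnd p)) \<odot>\<^bsub>E\<^esub> pfst (psnd p), psnd (psnd p)\<rangle>)"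
    using a X unfolding target_proj_def E_def
    by (auto simp: groupoid_step_simps mor_set_def new_edge_tgt_map subset_of_module_def subset_iff
        intro!: restrict_ext)
qed (use a in \<open>simp add: groupoid_step_simps E_def\<close>)

text \<open>Each recursive case asserts an identity of maps and one of laws. The extension in the
  copy case takes a law as its argument, so it is the identities of laws that can be iterated from
  one label to the next.\<close>

theorem theorem5p4:
  fixes K :: "'k ring" and V :: "('k, 'v) module" and U :: "'v set"
    and N \<alpha> \<beta> :: "nat set" and i :: nat
    and G :: "nat set \<Rightarrow> ('k, 'v) linear_set \<Rightarrow> ('k, 'v, 'x) nfold_groupoid"
    and GU :: "nat set \<Rightarrow> ('k, 'v, 'x) nfold_groupoid"
  assumes "cring K" and "module K V" and "U \<subseteq> carrier V"
    and "finite N" and "\<alpha> \<subseteq> N" and "i \<in> \<alpha>" and "\<beta> = \<alpha> - {i}"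
    and "G = nfold_groupoid_of K"
    and "GU = (\<lambda>M. G M (Vec ` U, vec_module V))"
  shows
    "polynomial_via K (amb (GU N) \<alpha>) (amb (GU N) \<beta>) (vset (GU N) \<alpha>) (vset (GU N) \<beta>)
       (tgt (edge (GU N) \<beta> \<alpha>)) (target_proj K (GU N) \<beta> \<alpha>)
   \<and> (\<forall>a\<^sub>1. N = {a\<^sub>1} \<longrightarrow>
        (\<forall>v\<^sub>0 v\<^sub>1 t\<^sub>1. v\<^sub>0 \<in> U \<and> v\<^sub>1 \<in> carrier V \<and> t\<^sub>1 \<in> carrier K \<and> v\<^sub>0 \<oplus>\<^bsub>V\<^esub> t\<^sub>1 \<odot>\<^bsub>V\<^esub> v\<^sub>1 \<in> U \<longrightarrow>
           target_proj K (GU {a\<^sub>1}) {} {a\<^sub>1} \<langle>Vec v\<^sub>0, \<langle>Vec v\<^sub>1, Scal t\<^sub>1\<rangle>\<rangle>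
             = \<langle>Vec (v\<^sub>0 \<oplus>\<^bsub>V\<^esub> t\<^sub>1 \<odot>\<^bsub>V\<^esub> v\<^sub>1), Scal t\<^sub>1\<rangle>))
   \<and> (\<forall>a\<^sub>n N'. card N > 1 \<and> a\<^sub>n = Max N \<and> N' = N - {a\<^sub>n} \<longrightarrow>
        (i \<le> Max \<alpha> \<and> Max \<alpha> < a\<^sub>n \<longrightarrow>
           target_proj K (GU N) \<beta> \<alpha> = times_id K (vset (GU N') \<alpha>) (target_proj K (GU N') \<beta> \<alpha>) \<and>
           tgt (edge (GU N) \<beta> \<alpha>)
             = obj_law K (amb (GU N') \<alpha>) (amb (GU N') \<beta>) (tgt (edge (GU N') \<beta> \<alpha>)))
      \<and> (\<forall>\<alpha>' \<beta>'. i < Max \<alpha> \<and> Max \<alpha> = a\<^sub>n \<and> \<alpha>' = \<alpha> - {a\<^sub>n} \<and> \<beta>' = \<beta> - {a\<^sub>n} \<longrightarrow>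
           target_proj K (GU N) \<beta> \<alpha>
             = ext_map K (amb (GU N') \<alpha>') (amb (GU N') \<beta>') (vset (GU N') \<alpha>')
                 (tgt (edge (GU N') \<beta>' \<alpha>')) \<and>
           tgt (edge (GU N) \<beta> \<alpha>)
             = mor_law K (amb (GU N') \<alpha>') (amb (GU N') \<beta>') (tgt (edge (GU N') \<beta>' \<alpha>')))
      \<and> (\<forall>\<alpha>' X E. i = Max \<alpha> \<and> Max \<alpha> = a\<^sub>n \<and> \<alpha>' = \<alpha> - {a\<^sub>n}
             \<and> X = vset (GU N') \<alpha>' \<and> E = amb (GU N') \<alpha>' \<longrightarrow>
           \<alpha>' = \<beta> \<and>
           target_proj K (GU N) \<beta> \<alpha> = target_proj K (G {a\<^sub>n} (X, E)) {} {a\<^sub>n} \<and>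
           tgt (edge (GU N) \<beta> \<alpha>) = tgt (edge (G {a\<^sub>n} (X, E)) {} {a\<^sub>n}) \<and>
           (\<forall>x v t. x \<in> X \<and> v \<in> carrier E \<and> t \<in> carrier K \<and> x \<oplus>\<^bsub>E\<^esub> t \<odot>\<^bsub>E\<^esub> v \<in> X \<longrightarrow>
              target_proj K (GU N) \<beta> \<alpha> \<langle>x, \<langle>v, Scal t\<rangle>\<rangle> = \<langle>x \<oplus>\<^bsub>E\<^esub> t \<odot>\<^bsub>E\<^esub> v, Scal t\<rangle>)))"
  (is "?poly \<and> ?single \<and> ?step")
proof (intro conjI)
  have vec: "module K (vec_module V)" by (rule vec_module_module[OF assms(2)])
  have L: "subset_of_module K (snd (Vec ` U, vec_module V)) (fst (Vec ` U, vec_module V))"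
    using vec assms(3) by (auto simp: subset_of_module_def vec_module_def)
  have GU: "GU M = nfold_groupoid_of K M (Vec ` U, vec_module V)" for M
    using assms(8,9) by simp
  note \<beta> = \<open>\<beta> = \<alpha> - {i}\<close>
  have props: "subset_of_module K (amb (GU M) \<gamma>) (vset (GU M) \<gamma>)"
    "\<gamma> \<subseteq> M \<Longrightarrow> j \<in> \<gamma> \<Longrightarrow> law_restricts K (amb (GU M) \<gamma>) (vset (GU M) \<gamma>) (amb (GU M) (\<gamma> - {j}))
      (vset (GU M) (\<gamma> - {j})) (tgt (edge (GU M) (\<gamma> - {j}) \<gamma>))" if "finite M" for M \<gamma> j
    using nfold_groupoid_properties[OF L that] unfolding GU by blast+
  \<comment> \<open>The restriction in \<open>target_proj\<close> supplies the extensionality that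
    \<open>polynomial_via\<close> demands.\<close>
  from props(2)[OF assms(4-6)] show ?poly
    unfolding \<beta> polynomial_via_def target_proj_def by (auto simp: law_restricts_def)
  show ?single
  proof (intro allI impI)
    fix a v\<^sub>0 v\<^sub>1 t
    assume *: "v\<^sub>0 \<in> U \<and> v\<^sub>1 \<in> carrier V \<and> t \<in> carrier K \<and> v\<^sub>0 \<oplus>\<^bsub>V\<^esub> t \<odot>\<^bsub>V\<^esub> v\<^sub>1 \<in> U"
    let ?E = "vec_module V"
    have E: "Vec v\<^sub>0 \<in> carrier ?E" "Vec v\<^sub>1 \<in> carrier ?E"
      and add: "Vec v\<^sub>0 \<oplus>\<^bsub>?E\<^esub> t \<odot>\<^bsub>?E\<^esub> Vec v\<^sub>1 = Vec (v\<^sub>0 \<oplus>\<^bsub>V\<^esub> t \<odot>\<^bsub>V\<^esub> v\<^sub>1)"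
      using * assms(3) by (auto simp: vec_module_def)
    \<comment> \<open>A restricted function yields the formula only where it is defined, so the
      triple has to be recognised as a morphism.\<close>
    have "\<langle>Vec v\<^sub>0, \<langle>Vec v\<^sub>1, Scal t\<rangle>\<rangle> \<in> mor_set K ?E (Vec ` U)"
      using * add E by (simp add: mor_set_def)
    then show "target_proj K (GU {a}) {} {a} \<langle>Vec v\<^sub>0, \<langle>Vec v\<^sub>1, Scal t\<rangle>\<rangle>
        = \<langle>Vec (v\<^sub>0 \<oplus>\<^bsub>V\<^esub> t \<odot>\<^bsub>V\<^esub> v\<^sub>1), Scal t\<rangle>"
      using * add
      by (simp add: GU nfold_groupoid_of_singleton target_proj_def groupoid_step_simps zerofold_simps
          new_edge_tgt_map[OF vec E])
  qed
  define a where "a = Max N"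
  let ?C = "GU (N - {a})"
  have fin: "finite (N - {a})" using assms(4) by simp
  have "N \<noteq> {}" using assms(5,6) by blast
  then have step: "GU N = groupoid_step K a ?C"
    using nfold_groupoid_of_Max[OF assms(4), of K "(Vec ` U, vec_module V)"] by (simp add: GU a_def)
  have fin\<alpha>: "finite \<alpha>" "\<alpha> \<noteq> {}" using finite_subset[OF assms(5,4)] assms(6) by auto
  note X = props(1)[OF fin] and P = props(2)[OF fin]
  have old: "target_proj K (GU N) \<beta> \<alpha> = times_id K (vset ?C \<alpha>) (target_proj K ?C \<beta> \<alpha>) \<and>
      tgt (edge (GU N) \<beta> \<alpha>) = obj_law K (amb ?C \<alpha>) (amb ?C \<beta>) (tgt (edge ?C \<beta> \<alpha>))"
    if "Max \<alpha> < a"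
  proof -
    \<comment> \<open>Every element of \<alpha> is at most Max \<alpha>, which is smaller than
      a.\<close>
    have a: "a \<notin> \<alpha>" "a \<notin> \<beta>" using Max_ge[OF fin\<alpha>(1), of a] that unfolding \<beta> by auto
    then have "\<alpha> \<subseteq> N - {a}" using assms(5) by auto
    from P[OF this assms(6)] show ?thesis
      unfolding step \<beta>[symmetric] by (intro target_proj_old_edge[OF a X X])
  qed
  have copy: "target_proj K (GU N) \<beta> \<alpha>
        = ext_map K (amb ?C (\<alpha> - {a})) (amb ?C (\<beta> - {a})) (vset ?C (\<alpha> - {a}))
            (tgt (edge ?C (\<beta> - {a}) (\<alpha> - {a}))) \<and>
      tgt (edge (GU N) \<beta> \<alpha>)
        = mor_law K (amb ?C (\<alpha> - {a})) (amb ?C (\<beta> - {a})) (tgt (edge ?C (\<beta> - {a}) (\<alpha> - {a})))"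
    if "i < Max \<alpha>" "Max \<alpha> = a"
  proof -
    \<comment> \<open>The maximum a belongs to \<alpha>, and removing i < a leaves it in \<beta>;
      the label i belongs to the smaller groupoid.\<close>
    have a: "a \<in> \<alpha>" "a \<in> \<beta>" "i \<in> \<alpha> - {a}"
      using Max_in[OF fin\<alpha>] assms(6) that unfolding \<beta> by auto
    have \<beta>': "\<alpha> - {a} - {i} = \<beta> - {a}" using \<beta> by auto
    have "\<alpha> - {a} \<subseteq> N - {a}" using assms(5) by auto
    from P[OF this a(3)] show ?thesis
      unfolding step \<beta>' by (intro target_proj_copy_edge[OF a(1,2) X X])
  qed
  have new: "\<alpha> - {a} = \<beta> \<and>
      target_proj K (GU N) \<beta> \<alpha> = target_proj K (G {a} (vset ?C \<beta>, amb ?C \<beta>)) {} {a} \<and>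
      tgt (edge (GU N) \<beta> \<alpha>) = tgt (edge (G {a} (vset ?C \<beta>, amb ?C \<beta>)) {} {a}) \<and>
      (\<forall>x v t. x \<in> vset ?C \<beta> \<and> v \<in> carrier (amb ?C \<beta>) \<and> t \<in> carrier K \<and>
           x \<oplus>\<^bsub>amb ?C \<beta>\<^esub> t \<odot>\<^bsub>amb ?C \<beta>\<^esub> v \<in> vset ?C \<beta> \<longrightarrow>
         target_proj K (GU N) \<beta> \<alpha> \<langle>x, \<langle>v, Scal t\<rangle>\<rangle> = \<langle>x \<oplus>\<^bsub>amb ?C \<beta>\<^esub> t \<odot>\<^bsub>amb ?C \<beta>\<^esub> v, Scal t\<rangle>)"
    if "i = a"
  proof -
    have a: "a \<in> \<alpha>" "\<beta> = \<alpha> - {a}" using that assms(6) \<beta> by auto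
    let ?L = "(vset ?C \<beta>, amb ?C \<beta>)"
    \<comment> \<open>The groupoid of the single label a over (X, E) is one step over a 0-fold
      groupoid, whose vertex is (X, E) throughout. Both projections thus have the same explicit
      form, and both target laws are that of the new edge over E.\<close>
    note single = target_proj_new_edge[where \<alpha> = "{a}" and a = a and C = "zerofold ?L :: ('k, 'v, 'x) nfold_groupoid",
        simplified zerofold_simps fst_conv snd_conv, OF X]
    show ?thesis
      using single target_proj_new_edge[OF X a(1)]
      by (auto simp: step a(2) assms(8) nfold_groupoid_of_singleton mor_set_def)
  qed
  show ?step
    using old copy new unfolding a_def by auto
qed

end
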